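(* $\mathsf{1XCAP} = \mathsf{P}$, i.e., the class of languages decided in polynomial time by one-cell-decision XCAs equals the class of languages decidable in polynomial time by deterministic Turing machines.
   Context: An XCA (expanding cellular automaton) is a one-dimensional cellular automaton with state set $Q$, neighborhood $\{-1,0,1\}$, local rule $\delta\colon Q^3\to Q$, quiescent state $q$ and distinguished hidden state $\odot$, where $\delta(\ell)=\odot$ is allowed only if the middle entry of $\ell$ is $\odot$. Cells not in state $q$ (and visible) are active; active cells may not become quiescent. In each global step, every visible cell is updated by the usual CA rule, and between each pair of adjacent visible cells $c(z),c(z+1)$ a hidden cell takes state $\delta(c(z),\odot,c(z+1))$ and is inserted between them; afterwards all cells in state $\odot$ are deleted (contracting the configuration). The input $w$ is written on cells $0,\dots,|w|-1$, surrounded by quiescent cells. A one-cell-decision XCA (1XCA) has an accept state $a$ and a reject state $r$ and accepts (resp. rejects) and halts if and only if the decision cell — the cell that is the leftmost active cell (cell $0$) in the initial configuration — is in state $a$ (resp. $r$). $\mathsf{1XCAP}$ is the class of languages decided by 1XCAs halting on every input within a number of steps polynomial in $|w|$.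
   Formalization: A 1XCA need only halt and decide correctly on nonempty inputs (the empty word has no active cell, hence no decision cell), so membership of the empty word is unconstrained; quiescence of q is read as δ(q,q,q)=q and δ(q,⊙,q)=⊙. *)

theory Defs
  imports Main
begin

text \<open>Input alphabet: a finite type 'a.  Tape symbols and XCA states live in the
  type 'a + nat: Inl x is the input symbol x, Inr n are additional symbols/states.\<close>

record 'a tm =
  tm_states :: "nat set"
  tm_syms   :: "('a + nat) set"
  tm_blank  :: "'a + nat"
  tm_delta  :: "nat \<Rightarrow> ('a + nat) \<Rightarrow> nat \<times> ('a + nat) \<times> int"
  tm_start  :: nat
  tm_acc    :: nat
  tm_rej    :: nat

definition tm_wf :: "'a tm \<Rightarrow> bool" where
  "tm_wf M \<longleftrightarrow>
     finite (tm_states M) \<and> finite (tm_syms M) \<and>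
     range Inl \<subseteq> tm_syms M \<and> tm_blank M \<in> tm_syms M \<and> tm_blank M \<notin> range Inl \<and>
     tm_start M \<in> tm_states M \<and> tm_acc M \<in> tm_states M \<and> tm_rej M \<in> tm_states M \<and>
     tm_acc M \<noteq> tm_rej M \<and>
     (\<forall>p\<in>tm_states M. \<forall>x\<in>tm_syms M.
        fst (tm_delta M p x) \<in> tm_states M \<and>
        fst (snd (tm_delta M p x)) \<in> tm_syms M \<and>
        snd (snd (tm_delta M p x)) \<in> {-1, 0, 1})"

type_synonym 'a tm_config = "nat \<times> (int \<Rightarrow> 'a + nat) \<times> int"

definition tm_init :: "'a tm \<Rightarrow> 'a list \<Rightarrow> 'a tm_config" where
  "tm_init M w = (tm_start M,
     (\<lambda>i. if 0 \<le> i \<and> i < int (length w) then Inl (w ! nat i) else tm_blank M), 0)"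

definition tm_step :: "'a tm \<Rightarrow> 'a tm_config \<Rightarrow> 'a tm_config" where
  "tm_step M cfg = (case cfg of (p, tape, h) \<Rightarrow>
     if p = tm_acc M \<or> p = tm_rej M then (p, tape, h)
     else (case tm_delta M p (tape h) of (p', y, m) \<Rightarrow> (p', tape(h := y), h + m)))"

definition tm_run :: "'a tm \<Rightarrow> 'a list \<Rightarrow> nat \<Rightarrow> 'a tm_config" where
  "tm_run M w t = (tm_step M ^^ t) (tm_init M w)"

definition tm_decides_in_time :: "'a tm \<Rightarrow> 'a list set \<Rightarrow> (nat \<Rightarrow> nat) \<Rightarrow> bool" where
  "tm_decides_in_time M L T \<longleftrightarrow>
     (\<forall>w. \<exists>t \<le> T (length w).
        (fst (tm_run M w t) = tm_acc M \<or> fst (tm_run M w t) = tm_rej M) \<and>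
        (fst (tm_run M w t) = tm_acc M \<longleftrightarrow> w \<in> L))"

definition class_P :: "'a list set set" where
  "class_P = {L. \<exists>M c k. tm_wf M \<and> tm_decides_in_time M L (\<lambda>n. c * n ^ k + c)}"

record 'a xca =
  xca_states :: "('a + nat) set"
  xca_delta  :: "('a + nat) \<Rightarrow> ('a + nat) \<Rightarrow> ('a + nat) \<Rightarrow> ('a + nat)"
  xca_q      :: "'a + nat"
  xca_hid    :: "'a + nat"
  xca_acc    :: "'a + nat"
  xca_rej    :: "'a + nat"

definition xca_wf :: "'a xca \<Rightarrow> bool" where
  "xca_wf A \<longleftrightarrow>
     finite (xca_states A) \<and> range Inl \<subseteq> xca_states A \<and>
     xca_q A \<in> xca_states A \<and> xca_hid A \<in> xca_states A \<and>
     xca_q A \<notin> range Inl \<and> xca_hid A \<notin> range Inl \<and> xca_q A \<noteq> xca_hid A \<and>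
     xca_acc A \<in> xca_states A \<and> xca_rej A \<in> xca_states A \<and> xca_acc A \<noteq> xca_rej A \<and>
     xca_acc A \<notin> {xca_q A, xca_hid A} \<and> xca_rej A \<notin> {xca_q A, xca_hid A} \<and>
     (\<forall>x\<in>xca_states A. \<forall>y\<in>xca_states A. \<forall>z\<in>xca_states A.
        xca_delta A x y z \<in> xca_states A \<and>
        (xca_delta A x y z = xca_hid A \<longrightarrow> y = xca_hid A) \<and>
        (y \<noteq> xca_q A \<and> y \<noteq> xca_hid A \<longrightarrow> xca_delta A x y z \<noteq> xca_q A)) \<and>
     xca_delta A (xca_q A) (xca_q A) (xca_q A) = xca_q A \<and>
     xca_delta A (xca_q A) (xca_hid A) (xca_q A) = xca_hid A"

text \<open>A configuration is represented by a finite list of visible cells (all cells outside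
  the list are quiescent) together with the position of the decision cell in that list.\<close>
type_synonym 'a xca_config = "('a + nat) list \<times> nat"

definition cell_at :: "'a xca \<Rightarrow> ('a + nat) list \<Rightarrow> int \<Rightarrow> 'a + nat" where
  "cell_at A c i = (if 0 \<le> i \<and> i < int (length c) then c ! nat i else xca_q A)"

definition xca_step :: "'a xca \<Rightarrow> 'a xca_config \<Rightarrow> 'a xca_config" where
  "xca_step A cfg = (case cfg of (c, d) \<Rightarrow>
     let ext = [xca_q A] @ c @ [xca_q A];
         n = length ext;
         vis = (\<lambda>i::nat. xca_delta A (cell_at A ext (int i - 1)) (ext ! i) (cell_at A ext (int i + 1)));
         hid = (\<lambda>i::nat. xca_delta A (ext ! i) (xca_hid A) (ext ! (i + 1)));
         inter = concat (map (\<lambda>i. [vis i, hid i]) [0..<n - 1]) @ [vis (n - 1)]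
     in (filter (\<lambda>s. s \<noteq> xca_hid A) inter,
         length (filter (\<lambda>s. s \<noteq> xca_hid A) (take (2 * (d + 1)) inter))))"

definition xca_init :: "'a list \<Rightarrow> 'a xca_config" where
  "xca_init w = (map Inl w, 0)"

definition xca_dec :: "'a xca \<Rightarrow> 'a list \<Rightarrow> nat \<Rightarrow> 'a + nat" where
  "xca_dec A w t = (case (xca_step A ^^ t) (xca_init w) of (c, d) \<Rightarrow> c ! d)"

definition xca_decides_in_time :: "'a xca \<Rightarrow> 'a list set \<Rightarrow> (nat \<Rightarrow> nat) \<Rightarrow> bool" where
  "xca_decides_in_time A L T \<longleftrightarrow>
     (\<forall>w. w \<noteq> [] \<longrightarrow> (\<exists>t \<le> T (length w).
        (xca_dec A w t = xca_acc A \<or> xca_dec A w t = xca_rej A) \<and>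
        (\<forall>t' < t. xca_dec A w t' \<noteq> xca_acc A \<and> xca_dec A w t' \<noteq> xca_rej A) \<and>
        (xca_dec A w t = xca_acc A \<longleftrightarrow> w \<in> L)))"

definition class_1XCAP :: "'a list set set" where
  "class_1XCAP = {L. \<exists>A c k. xca_wf A \<and> xca_decides_in_time A L (\<lambda>n. c * n ^ k + c)}"

end

theory Submission
  imports Defs "HOL-Library.Countable"
begin

text \<open>A Turing machine is simulated by an automaton that never reveals a hidden cell: a cell stores
  a tape symbol and possibly the head, and the verdict is broadcast from the halting head to the
  decision cell.

  Conversely, an expanding automaton may reach exponential size, but since visible cells are never
  deleted, the state of the decision cell after \<open>T\<close> steps depends only on the cells within
  distance \<open>T\<close> of it.  The Turing machine therefore keeps the \<open>N\<close> cells nearest to the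
  decision cell on either side, marks cells as unknown once they are no longer determined by this
  window, drops whatever is pushed out of it, and restarts with \<open>N + 1\<close> when the decision
  cell itself becomes unknown.  The two sides evolve like half-lines and are stored on two tracks of
  a tape that is processed by alternating left-to-right and right-to-left sweeps.\<close>

section \<open>Cells that carry a Turing machine tape\<close>

text \<open>The time bound of the automaton is only a hypothesis, and the Turing machine never
  computes it. It needs another signal that its window was too short, and the unknown marks provide
  it. The known part recedes by at most one cell per step, so a window longer than the halting time
  never triggers a restart. Hence the number of restarts is at most the halting time and the total
  cost stays polynomial.

  A pass with finite control cannot insert an unbounded number of revealed cells at once, since it
  would have to buffer them. Each round therefore opens room for one cell per track, and one
  simulated step costs linearly many rounds.

  In the other direction timing matters: the decision cell must show no verdict before the right one
  arrives, and the halting head may be far away from it, though never farther than the running time.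

  The automaton is only asked about nonempty words; the answer for the empty word is a constant
  built into the Turing machine.\<close>

datatype 'a view = Raw 'a | Quiet | Hidden | Halted bool | Cell "'a + nat" "nat option"

instance view :: (countable) countable
  by countable_datatype

fun encode_view :: "'a::countable view \<Rightarrow> 'a + nat" where
  "encode_view (Raw a) = Inl a"
| "encode_view v = Inr (to_nat v)"

text \<open>The test \<open>to_nat (from_nat k) = k\<close> discards codes outside the range of
  \<open>to_nat\<close>, where \<open>from_nat\<close> is arbitrary. It ensures that only the code
  of \<open>Hidden\<close> decodes to \<open>Hidden\<close>, for every argument and not just for
  states.\<close>

fun decode_view :: "'a::countable + nat \<Rightarrow> 'a view" where
  "decode_view (Inl a) = Raw a"
| "decode_view (Inr k) = (if to_nat (from_nat k :: 'a view) = k then from_nat k else Quiet)"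

declare encode_view.simps(2-5) [simp del] decode_view.simps(2) [simp del]

lemma decode_encode_view [simp]: "decode_view (encode_view v) = v"
  by (cases v) (simp_all add: encode_view.simps decode_view.simps(2))

lemma decode_view_HiddenD: "decode_view y = Hidden \<Longrightarrow> y = encode_view Hidden"
  by (cases y) (simp_all add: encode_view.simps decode_view.simps(2) split: if_splits)

lemma encode_view_inject [simp]: "encode_view u = encode_view v \<longleftrightarrow> u = v"
  by (metis decode_encode_view)

lemma encode_view_eq_Inl [simp]:
  "encode_view v = Inl a \<longleftrightarrow> v = Raw a"
  by (cases v) (auto simp: encode_view.simps)

abbreviation tm_halting :: "'a tm \<Rightarrow> nat \<Rightarrow> bool" where
  "tm_halting M p \<equiv> p = tm_acc M \<or> p = tm_rej M"

text \<open>\<open>m\<close> is the direction of the move seen from the cell that holds the head: a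
  cell asks its left neighbour for \<open>1\<close>, itself for \<open>0\<close> and its right
  neighbour for \<open>-1\<close>.\<close>

definition outgoing_head :: "'a tm \<Rightarrow> int \<Rightarrow> 'a view \<Rightarrow> nat option" where
  "outgoing_head M m v = (case v of
     Cell s (Some p) \<Rightarrow>
       if \<not> tm_halting M p \<and> snd (snd (tm_delta M p s)) = m
       then Some (fst (tm_delta M p s)) else None
   | _ \<Rightarrow> None)"

definition incoming_head :: "'a tm \<Rightarrow> 'a view \<Rightarrow> 'a view \<Rightarrow> 'a view \<Rightarrow> nat option" where
  "incoming_head M l y r =
     (case outgoing_head M 1 l of Some p \<Rightarrow> Some p
      | None \<Rightarrow> (case outgoing_head M 0 y of Some p \<Rightarrow> Some p
        | None \<Rightarrow> outgoing_head M (-1) r))"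

text \<open>Input cells carry no head, so the first step turns \<open>Raw\<close> into
  \<open>Cell\<close> and puts the head on the only input cell with a \<open>Quiet\<close> left
  neighbour. \<open>Halted\<close> is absorbing and spreads by one cell per step. Nothing but
  \<open>Quiet\<close> becomes \<open>Quiet\<close>, so a blank left behind by the head stays a
  \<open>Cell\<close>.\<close>

fun tm_rule :: "'a tm \<Rightarrow> 'a view \<Rightarrow> 'a view \<Rightarrow> 'a view \<Rightarrow> 'a view" where
  "tm_rule M l Hidden r = Hidden"
| "tm_rule M l (Halted b) r = Halted b"
| "tm_rule M l (Raw a) r = Cell (Inl a) (if l = Quiet then Some (tm_start M) else None)"
| "tm_rule M (Halted b) Quiet r = Halted b"
| "tm_rule M l Quiet (Halted b) = Halted b"
| "tm_rule M l Quiet r =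
     (case incoming_head M l Quiet r of None \<Rightarrow> Quiet | Some p \<Rightarrow> Cell (tm_blank M) (Some p))"
| "tm_rule M (Halted b) (Cell s None) r = Halted b"
| "tm_rule M l (Cell s None) (Halted b) = Halted b"
| "tm_rule M l (Cell s None) r = Cell s (incoming_head M l (Cell s None) r)"
| "tm_rule M l (Cell s (Some p)) r =
     (if p = tm_acc M then Halted True else if p = tm_rej M then Halted False
      else Cell (fst (snd (tm_delta M p s))) (incoming_head M l (Cell s (Some p)) r))"

definition tm_views :: "'a tm \<Rightarrow> 'a view set" where
  "tm_views M = range Raw \<union> {Quiet, Hidden, Halted True, Halted False} \<union>
     (\<lambda>(s, h). Cell s h) ` (tm_syms M \<times> insert None (Some ` tm_states M))"

definition tm_xca :: "('a::countable) tm \<Rightarrow> 'a xca" where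
  "tm_xca M = \<lparr>
     xca_states = encode_view ` tm_views M,
     xca_delta = (\<lambda>x y z. encode_view (tm_rule M (decode_view x) (decode_view y) (decode_view z))),
     xca_q = encode_view Quiet,
     xca_hid = encode_view Hidden,
     xca_acc = encode_view (Halted True),
     xca_rej = encode_view (Halted False)\<rparr>"

lemma Cell_in_tm_views:
  "Cell s h \<in> tm_views M \<longleftrightarrow> s \<in> tm_syms M \<and> (\<forall>p. h = Some p \<longrightarrow> p \<in> tm_states M)"
  by (cases h) (auto simp: tm_views_def image_iff)

lemma simple_in_tm_views [simp]:
  "Raw a \<in> tm_views M" "Quiet \<in> tm_views M" "Hidden \<in> tm_views M" "Halted b \<in> tm_views M"
  by (cases b; auto simp: tm_views_def)+

lemma outgoing_head_in_states:
  assumes "tm_wf M" "v \<in> tm_views M" "outgoing_head M m v = Some p"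
  shows "p \<in> tm_states M"
  using assms
  by (auto simp: outgoing_head_def tm_wf_def Cell_in_tm_views split: view.splits option.splits if_splits)

lemma incoming_head_in_states:
  assumes "tm_wf M" "l \<in> tm_views M" "y \<in> tm_views M" "r \<in> tm_views M"
    "incoming_head M l y r = Some p"
  shows "p \<in> tm_states M"
  using assms outgoing_head_in_states[OF assms(1)]
  by (auto simp: incoming_head_def split: option.splits)

lemma tm_rule_in_views:
  assumes wf: "tm_wf M" and mem: "l \<in> tm_views M" "y \<in> tm_views M" "r \<in> tm_views M"
  shows "tm_rule M l y r \<in> tm_views M"
proof -
  note inc = incoming_head_in_states[OF wf mem]
  show ?thesis
    using inc mem wf
    by (induction M l y r rule: tm_rule.induct)
       (auto simp: Cell_in_tm_views tm_wf_def split: option.splits)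
qed

lemma tm_rule_not_hidden: "tm_rule M l y r = Hidden \<Longrightarrow> y = Hidden"
  by (induction M l y r rule: tm_rule.induct) (auto split: option.splits if_splits)

lemma tm_rule_not_quiet: "tm_rule M l y r = Quiet \<Longrightarrow> y = Quiet"
  by (induction M l y r rule: tm_rule.induct) (auto split: option.splits if_splits)

lemma tm_xca_wf:
  fixes M :: "('a::finite) tm"
  assumes "tm_wf M"
  shows "xca_wf (tm_xca M)"
proof -
  have "finite (tm_views M)"
    using assms by (auto simp: tm_views_def tm_wf_def)
  moreover have "range Inl \<subseteq> encode_view ` tm_views M"
  proof
    fix y :: "'a + nat" assume "y \<in> range Inl"
    then obtain a where "y = encode_view (Raw a)" by auto
    then show "y \<in> encode_view ` tm_views M" by (metis imageI simple_in_tm_views(1))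
  qed
  moreover have "tm_rule M Quiet Quiet Quiet = Quiet" "tm_rule M Quiet Hidden Quiet = Hidden"
    by (simp_all add: incoming_head_def outgoing_head_def)
  ultimately show ?thesis
    using tm_rule_in_views[OF assms] tm_rule_not_hidden[of M] tm_rule_not_quiet[of M]
    by (auto simp: xca_wf_def tm_xca_def simp del: tm_rule.simps)
qed

section \<open>Automata that never reveal hidden cells\<close>

lemma filter_interleave_hidden:
  assumes "\<And>i. h i = z" "\<And>i. v i \<noteq> z"
  shows "filter (\<lambda>s. s \<noteq> z) (concat (map (\<lambda>i. [v i, h i]) js)) = map v js"
  using assms by (induction js) auto

text \<open>For \<open>k = d + 1\<close> this is the prefix in which \<open>xca_step\<close> counts
  the survivors before the decision cell.\<close>

lemma take_interleave:
  "k \<le> n \<Longrightarrow> take (2 * k) (concat (map (\<lambda>i::nat. [v i, h i]) [0..<n]) @ zs)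
     = concat (map (\<lambda>i. [v i, h i]) [0..<k])"
proof (induction n arbitrary: zs)
  case (Suc n)
  show ?case
  proof (cases "k = Suc n")
    case True
    have "length (concat (map (\<lambda>i::nat. [v i, h i]) [0..<m])) = 2 * m" for m
      by (induction m) auto
    then show ?thesis using True by (simp del: upt_Suc)
  next
    case False
    then show ?thesis using Suc.IH[of "[v n, h n] @ zs"] Suc.prems by simp
  qed
qed simp

text \<open>If hidden cells stay hidden, a step is that of an ordinary cellular automaton. The list
  gains one cell on either side and the decision index moves by one, so coordinates relative to the
  decision cell do not change.\<close>

lemma cell_at_step_no_hidden:
  assumes hid: "\<And>x z. xca_delta A x (xca_hid A) z = xca_hid A"
    and vis: "\<And>x y z. xca_delta A x y z = xca_hid A \<Longrightarrow> y = xca_hid A"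
    and q: "xca_q A \<noteq> xca_hid A" "xca_delta A (xca_q A) (xca_q A) (xca_q A) = xca_q A"
    and c: "xca_hid A \<notin> set c" and d: "d < length c"
    and step: "xca_step A (c, d) = (c', d')"
  shows "d' = Suc d" "length c' = length c + 2" "xca_hid A \<notin> set c'"
    "cell_at A c' (int d' + j) = xca_delta A (cell_at A c (int d + j - 1))
       (cell_at A c (int d + j)) (cell_at A c (int d + j + 1))"
proof -
  define ext where "ext = [xca_q A] @ c @ [xca_q A]"
  define v where "v = (\<lambda>i::nat. xca_delta A (cell_at A ext (int i - 1)) (ext ! i) (cell_at A ext (int i + 1)))"
  \<comment> \<open>\<open>v\<close> is only known to avoid the hidden state inside
    \<open>ext\<close>; the quiescent default extends this to every index, as
    \<open>filter_interleave_hidden\<close> demands.\<close>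
  define v' where "v' = (\<lambda>i. if i < length ext then v i else xca_q A)"
  have ext_hid: "ext ! i \<noteq> xca_hid A" if "i < length ext" for i
    using that c q(1) nth_mem[OF that] by (auto simp: ext_def)
  then have v: "v i \<noteq> xca_hid A" if "i < length ext" for i
    using that vis by (auto simp: v_def)
  then have v': "v' i \<noteq> xca_hid A" for i
    using q(1) by (simp add: v'_def)
  have n: "length ext = length c + 2" by (simp add: ext_def)
  define h where "h = (\<lambda>i::nat. xca_delta A (ext ! i) (xca_hid A) (ext ! (i + 1)))"
  have h: "h i = xca_hid A" for i by (simp add: h_def hid)
  define inter where "inter = concat (map (\<lambda>i. [v i, h i]) [0..<length ext - 1]) @ [v (length ext - 1)]"
  have inter: "inter = concat (map (\<lambda>i. [v' i, h i]) [0..<length ext - 1]) @ [v' (length ext - 1)]"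
  proof -
    have "map (\<lambda>i. [v i, h i]) [0..<length ext - 1] = map (\<lambda>i. [v' i, h i]) [0..<length ext - 1]"
      by (auto simp: v'_def)
    moreover have "v (length ext - 1) = v' (length ext - 1)" by (simp add: v'_def n)
    ultimately show ?thesis
      unfolding inter_def by (rule arg_cong2[where f = "\<lambda>a b. concat a @ [b]"])
  qed
  have st: "xca_step A (c, d) = (filter (\<lambda>s. s \<noteq> xca_hid A) inter,
         length (filter (\<lambda>s. s \<noteq> xca_hid A) (take (2 * (d + 1)) inter)))"
    by (simp only: xca_step_def Let_def split inter_def h_def v_def ext_def)
  have "filter (\<lambda>s. s \<noteq> xca_hid A) inter = map v' [0..<length ext - 1] @ [v' (length ext - 1)]"
    unfolding inter filter_append filter_interleave_hidden[OF h v'] using v' by simp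
  also have "\<dots> = map v' [0..<length ext]"
  proof -
    have "[0..<length ext] = [0..<length ext - 1] @ [length ext - 1]" by (simp add: n)
    then show ?thesis by (simp only: list.map map_append)
  qed
  finally have c': "c' = map v' [0..<length ext]"
    using step st by simp
  have "take (2 * (d + 1)) inter = concat (map (\<lambda>i. [v' i, h i]) [0..<d + 1])"
    unfolding inter by (rule take_interleave) (use d n in simp)
  then have "filter (\<lambda>s. s \<noteq> xca_hid A) (take (2 * (d + 1)) inter) = map v' [0..<d + 1]"
    using filter_interleave_hidden[of h "xca_hid A" v' "[0..<d + 1]"] h v' by simp
  then show d': "d' = Suc d"
    using step st by simp
  show "length c' = length c + 2" by (simp add: c' n)
  show "xca_hid A \<notin> set c'" using v' by (metis c' ex_map_conv)
  have e: "cell_at A ext i = cell_at A c (i - 1)" for i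
    by (auto simp: cell_at_def ext_def nth_append nth_Cons nat_diff_distrib split: nat.splits)
  have vc: "v i = xca_delta A (cell_at A c (int i - 2)) (cell_at A c (int i - 1)) (cell_at A c (int i))"
    if "i < length ext" for i
  proof -
    have "ext ! i = cell_at A ext (int i)" using that by (simp add: cell_at_def)
    then show ?thesis by (simp add: v_def e)
  qed
  show "cell_at A c' (int d' + j) = xca_delta A (cell_at A c (int d + j - 1))
       (cell_at A c (int d + j)) (cell_at A c (int d + j + 1))"
  proof (cases "0 \<le> int d' + j \<and> int d' + j < int (length ext)")
    case True
    then have "cell_at A c' (int d' + j) = v (nat (int d' + j))"
      by (auto simp: cell_at_def c' v'_def)
    also have "\<dots> = xca_delta A (cell_at A c (int d + j - 1))
       (cell_at A c (int d + j)) (cell_at A c (int d + j + 1))"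
      using True by (subst vc) (auto simp: d' algebra_simps)
    finally show ?thesis .
  next
    case False
    \<comment> \<open>Outside the new list all three old cells lie outside the old list, and
      quiescence persists.\<close>
    then show ?thesis using q(2) by (auto simp: cell_at_def c' d' n)
  qed
qed

text \<open>An ordinary automaton on the integers whose coordinate \<open>0\<close> is the decision
  cell at all times.\<close>

fun ca_run :: "'a xca \<Rightarrow> 'a list \<Rightarrow> nat \<Rightarrow> int \<Rightarrow> 'a + nat" where
  "ca_run A w 0 j = (if 0 \<le> j \<and> j < int (length w) then Inl (w ! nat j) else xca_q A)"
| "ca_run A w (Suc t) j =
     xca_delta A (ca_run A w t (j - 1)) (ca_run A w t j) (ca_run A w t (j + 1))"

lemma xca_dec_eq_ca_run:
  assumes hid: "\<And>x z. xca_delta A x (xca_hid A) z = xca_hid A"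
    and vis: "\<And>x y z. xca_delta A x y z = xca_hid A \<Longrightarrow> y = xca_hid A"
    and q: "xca_q A \<noteq> xca_hid A" "xca_delta A (xca_q A) (xca_q A) (xca_q A) = xca_q A"
    and inl: "xca_hid A \<notin> range Inl" and w: "w \<noteq> []"
  shows "xca_dec A w t = ca_run A w t 0"
proof -
  have "\<exists>c d. (xca_step A ^^ t) (xca_init w) = (c, d) \<and> d < length c \<and> xca_hid A \<notin> set c \<and>
     (\<forall>j. cell_at A c (int d + j) = ca_run A w t j)"
  proof (induction t)
    case 0
    then show ?case using w inl by (auto simp: xca_init_def cell_at_def)
  next
    case (Suc t)
    then obtain c d where IH: "(xca_step A ^^ t) (xca_init w) = (c, d)" "d < length c"
      "xca_hid A \<notin> set c" "\<And>j. cell_at A c (int d + j) = ca_run A w t j" by blast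
    obtain c' d' where st: "xca_step A (c, d) = (c', d')" by fastforce
    note s = cell_at_step_no_hidden[OF hid vis q IH(3) IH(2) st]
    show ?case
      using s IH(2) IH(4)[of "_ - 1"] IH(4)[of "_ + 1"] IH(4)
      by (intro exI[of _ c'] exI[of _ d']) (auto simp: IH(1) st algebra_simps)
  qed
  then obtain c d where "(xca_step A ^^ t) (xca_init w) = (c, d)" "d < length c"
     "cell_at A c (int d + 0) = ca_run A w t 0" by blast
  then show ?thesis by (simp add: xca_dec_def cell_at_def)
qed

section \<open>Turing machines on expanding automata\<close>

text \<open>A blank without head has two representations, because a cell that was once active cannot
  return to \<open>Quiet\<close>.\<close>

definition tm_cell :: "'a tm \<Rightarrow> 'a tm_config \<Rightarrow> int \<Rightarrow> 'a view \<Rightarrow> bool" where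
  "tm_cell M cfg j v \<longleftrightarrow> (case cfg of (p, tape, h) \<Rightarrow>
     v = Cell (tape j) (if j = h then Some p else None) \<or>
     v = Quiet \<and> tape j = tm_blank M \<and> j \<noteq> h)"

text \<open>Only the cell at \<open>h\<close> emits a head, and only in direction \<open>m\<close>;
  so exactly the cell at \<open>h + m\<close> receives one.\<close>

lemma tm_cell_step:
  assumes "\<And>i. tm_cell M (p, tape, h) i (g i)" "\<not> tm_halting M p"
    "snd (snd (tm_delta M p (tape h))) \<in> {-1, 0, 1}"
  shows "tm_cell M (tm_step M (p, tape, h)) j (tm_rule M (g (j - 1)) (g j) (g (j + 1)))"
proof -
  obtain p' y m where d: "tm_delta M p (tape h) = (p', y, m)" by (metis prod_cases3)
  have out: "outgoing_head M k (g i) = (if i = h \<and> k = m then Some p' else None)" for i k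
    using assms(1)[of i] assms(2) d by (auto simp: tm_cell_def outgoing_head_def)
  have inc: "incoming_head M (g (j - 1)) (g j) (g (j + 1)) = (if j = h + m then Some p' else None)"
    using assms(3) d by (auto simp: incoming_head_def out)
  have nh: "g i \<noteq> Halted b" for i b
    using assms(1)[of i] by (auto simp: tm_cell_def)
  have ru: "tm_rule M l Quiet r = (case incoming_head M l Quiet r of None \<Rightarrow> Quiet | Some p \<Rightarrow> Cell (tm_blank M) (Some p))"
    "tm_rule M l (Cell s None) r = Cell s (incoming_head M l (Cell s None) r)"
    if "\<And>b. l \<noteq> Halted b" "\<And>b. r \<noteq> Halted b" for l r s
    using that by (cases l; cases r; simp)+
  show ?thesis
  proof (cases "j = h")
    case True
    then have "g j = Cell (tape h) (Some p)" using assms(1)[of j] by (auto simp: tm_cell_def)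
    then show ?thesis using True inc assms(2) d by (auto simp: tm_cell_def tm_step_def)
  next
    case False
    then consider "g j = Cell (tape j) None" | "g j = Quiet" "tape j = tm_blank M"
      using assms(1)[of j] by (auto simp: tm_cell_def)
    then show ?thesis
      using False inc assms(2) d by cases (auto simp: tm_cell_def tm_step_def ru nh)
  qed
qed

lemma tm_run_Suc: "tm_run M w (Suc t) = tm_step M (tm_run M w t)"
  by (simp add: tm_run_def)

lemma tm_run_wf:
  assumes "tm_wf M" "tm_run M w t = (p, tape, h)"
  shows "p \<in> tm_states M \<and> (\<forall>i. tape i \<in> tm_syms M) \<and> \<bar>h\<bar> \<le> int t"
  using assms(2)
proof (induction t arbitrary: p tape h)
  case 0
  moreover have "Inl x \<in> tm_syms M" for x
    using assms(1) by (auto simp: tm_wf_def)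
  ultimately show ?case using assms(1) by (auto simp: tm_run_def tm_init_def tm_wf_def)
next
  case (Suc t)
  obtain p0 tape0 h0 where r: "tm_run M w t = (p0, tape0, h0)" by (metis prod_cases3)
  note IH = Suc.IH[OF r]
  obtain p' y m where d: "tm_delta M p0 (tape0 h0) = (p', y, m)" by (metis prod_cases3)
  have "p' \<in> tm_states M \<and> y \<in> tm_syms M \<and> m \<in> {-1, 0, 1}"
    using assms(1) IH d unfolding tm_wf_def by (metis fst_conv snd_conv)
  then show ?case using Suc.prems IH d
    by (auto simp: tm_run_Suc r tm_step_def split: if_splits)
qed

lemma tm_run_halted:
  assumes "tm_halting M (fst (tm_run M w t))" "t \<le> t'"
  shows "tm_run M w t' = tm_run M w t"
  using assms(2)
proof (induction t' rule: dec_induct)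
  case (step n)
  then show ?case using assms(1) by (cases "tm_run M w t") (auto simp: tm_run_Suc tm_step_def)
qed simp

text \<open>A cell on the rim of the larger ball has no head and a neighbour in the present ball, so
  it copies the verdict; cells farther out see neither a verdict nor a head.\<close>

lemma tm_rule_broadcast:
  assumes g: "\<And>i. if \<bar>i - h\<bar> \<le> int s then g i = Halted b else g i = Quiet \<or> (\<exists>x. g i = Cell x None)"
  shows "if \<bar>j - h\<bar> \<le> int (Suc s) then tm_rule M (g (j - 1)) (g j) (g (j + 1)) = Halted b
    else tm_rule M (g (j - 1)) (g j) (g (j + 1)) = Quiet \<or>
      (\<exists>x. tm_rule M (g (j - 1)) (g j) (g (j + 1)) = Cell x None)"
proof -
  note l = g[of "j - 1"] and m = g[of j] and r = g[of "j + 1"]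
  consider "\<bar>j - h\<bar> \<le> int s" | "\<bar>j - h\<bar> = int (Suc s)" | "\<bar>j - h\<bar> > int (Suc s)" by linarith
  then show ?thesis
  proof cases
    case 1 then show ?thesis using m by simp
  next
    case 2
    then have "\<bar>j - 1 - h\<bar> \<le> int s \<or> \<bar>j + 1 - h\<bar> \<le> int s" "\<not> \<bar>j - h\<bar> \<le> int s" by linarith+
    then show ?thesis using 2 l m r
      by (auto simp del: of_nat_Suc split: if_splits)
  next
    case 3
    then have "\<not> \<bar>j - 1 - h\<bar> \<le> int s" "\<not> \<bar>j + 1 - h\<bar> \<le> int s" "\<not> \<bar>j - h\<bar> \<le> int s" by linarith+
    then show ?thesis using 3 l m r
      by (auto simp: incoming_head_def outgoing_head_def)
  qed
qed

text \<open>The bound splits into one step that creates the cells, \<open>u\<close> steps of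
  simulation, one step that turns the halting head into a verdict, and at most \<open>u\<close>
  steps until the verdict reaches the decision cell, since the head is within distance
  \<open>u\<close> of it.\<close>

lemma tm_xca_decides:
  fixes M :: "('a::finite) tm"
  assumes wf: "tm_wf M" and dec: "tm_decides_in_time M L T"
  shows "xca_decides_in_time (tm_xca M) L (\<lambda>n. 2 * T n + 2)"
  unfolding xca_decides_in_time_def
proof (intro allI impI)
  fix w :: "'a list"
  assume w: "w \<noteq> []"
  let ?A = "tm_xca M"
  obtain t0 where t0: "t0 \<le> T (length w)" "tm_halting M (fst (tm_run M w t0))"
    "fst (tm_run M w t0) = tm_acc M \<longleftrightarrow> w \<in> L"
    using dec by (auto simp: tm_decides_in_time_def)
  \<comment> \<open>\<open>t0\<close> may lie past the first halt, but \<open>tm_cell_step\<close>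
    needs a running machine; so the simulation ends at the first halting time.\<close>
  define u where "u = (LEAST t. tm_halting M (fst (tm_run M w t)))"
  have u: "tm_halting M (fst (tm_run M w u))"
    unfolding u_def by (rule LeastI) (rule t0(2))
  have ut0: "u \<le> t0" unfolding u_def by (rule Least_le) (rule t0(2))
  have before: "\<not> tm_halting M (fst (tm_run M w t))" if "t < u" for t
    using that not_less_Least unfolding u_def by blast
  have run_u: "tm_run M w t0 = tm_run M w u" by (rule tm_run_halted[OF u ut0])
  obtain p tape h where cu: "tm_run M w u = (p, tape, h)" by (metis prod_cases3)
  define g where "g t j = decode_view (ca_run ?A w t j)" for t j
  have dec_eq: "xca_dec ?A w t = ca_run ?A w t 0" for t
  proof (rule xca_dec_eq_ca_run)
    show "xca_hid ?A \<notin> range Inl"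
      by (auto simp: tm_xca_def)
    show "y = xca_hid ?A" if "xca_delta ?A x y z = xca_hid ?A" for x y z
      using that by (auto simp: tm_xca_def
          dest!: tm_rule_not_hidden decode_view_HiddenD)
  qed (use w in
      \<open>auto simp: tm_xca_def incoming_head_def outgoing_head_def\<close>)
  have enc: "ca_run ?A w t j = encode_view (g t j)" for t j
  proof (cases t)
    case 0
    then show ?thesis by (simp add: g_def tm_xca_def)
  next
    case (Suc t')
    then show ?thesis by (simp add: g_def tm_xca_def)
  qed
  have g0: "g 0 j = (if 0 \<le> j \<and> j < int (length w) then Raw (w ! nat j) else Quiet)" for j
    by (auto simp: g_def tm_xca_def )
  have gSuc: "g (Suc t) j = tm_rule M (g t (j - 1)) (g t j) (g t (j + 1))" for t j
    by (simp add: g_def tm_xca_def)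
  have sim: "t \<le> u \<Longrightarrow> tm_cell M (tm_run M w t) j (g (Suc t) j)" for t j
  proof (induction t arbitrary: j)
    case 0
    have "w \<noteq> []" by fact
    then show ?case
      by (auto simp: gSuc g0 tm_run_def tm_init_def tm_cell_def incoming_head_def outgoing_head_def)
  next
    case (Suc t)
    obtain p' tape' h' where r: "tm_run M w t = (p', tape', h')" by (metis prod_cases3)
    have "p' \<in> tm_states M" "tape' h' \<in> tm_syms M" using tm_run_wf[OF wf r] by auto
    then have "snd (snd (tm_delta M p' (tape' h'))) \<in> {-1, 0, 1}"
      using wf by (auto simp: tm_wf_def)
    then show ?case
      using tm_cell_step[of M p' tape' h' "g (Suc t)" j] Suc before[of t]
      by (simp add: tm_run_Suc r gSuc[of "Suc t"])
  qed
  define b where "b = (p = tm_acc M)"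
  have acc_rej: "tm_acc M \<noteq> tm_rej M" using wf by (simp add: tm_wf_def)
  have fin: "if \<bar>j - h\<bar> \<le> int s then g (Suc (Suc (u + s))) j = Halted b
    else g (Suc (Suc (u + s))) j = Quiet \<or> (\<exists>x. g (Suc (Suc (u + s))) j = Cell x None)" for s j
  proof (induction s arbitrary: j)
    case 0
    have c: "tm_cell M (p, tape, h) i (g (Suc u) i)" for i using sim[of u i] cu by simp
    have out: "outgoing_head M k (g (Suc u) i) = None" for k i
      using c[of i] u cu by (auto simp: tm_cell_def outgoing_head_def)
    have nh: "g (Suc u) i \<noteq> Halted b" for i b
      using c[of i] by (auto simp: tm_cell_def)
    show ?case
    proof (cases "j = h")
      case True
      then show ?thesis using c[of j] u cu acc_rej
        by (auto simp: gSuc[of "Suc u"] tm_cell_def b_def)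
    next
      case False
      then show ?thesis using c[of j] nh[of "j - 1"] nh[of "j + 1"] out[of _ "j - 1"] out[of _ j] out[of _ "j + 1"]
        by (cases "g (Suc u) (j - 1)"; cases "g (Suc u) (j + 1)")
           (auto simp: gSuc[of "Suc u"] tm_cell_def incoming_head_def)
    qed
  next
    case (Suc s)
    then show ?case
      using tm_rule_broadcast[of h s "g (Suc (Suc (u + s)))" b j M] gSuc[of "Suc (Suc (u + s))"]
      by simp
  qed
  have h: "\<bar>h\<bar> \<le> int u" using tm_run_wf[OF wf cu] by simp
  define t where "t = Suc (Suc (u + nat \<bar>h\<bar>))"
  have gt: "g t 0 = Halted b" using fin[of 0 "nat \<bar>h\<bar>"] by (simp add: t_def)
  have pre: "g t' 0 \<noteq> Halted b'" if "t' < t" for t' b'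
  proof -
    \<comment> \<open>Before time \<open>t\<close> cell \<open>0\<close> holds raw input, a
      simulated tape cell, or a cell that the verdict has not reached yet.\<close>
    consider "t' = 0" | s where "t' = Suc s" "s \<le> u" | s where "t' = Suc (Suc (u + s))" "s < nat \<bar>h\<bar>"
    proof (cases t')
      case (Suc s)
      then show ?thesis
        using that that(1) \<open>t' < t\<close> le_Suc_ex[of "Suc u" s]
        by (cases "s \<le> u") (auto simp: t_def not_le Suc_le_eq intro: that)
    qed (use that in auto)
    then show ?thesis
    proof cases
      case 2 then show ?thesis using sim[of s 0] by (cases "tm_run M w s") (auto simp: tm_cell_def)
    next
      case 3 then show ?thesis using fin[of 0 s] by (auto split: if_splits)
    qed (simp add: g0)
  qed
  have "t \<le> 2 * T (length w) + 2" using h ut0 t0(1) by (simp add: t_def)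
  moreover have "b \<longleftrightarrow> w \<in> L" using t0(3) run_u cu by (simp add: b_def)
  moreover have "xca_acc ?A = encode_view (Halted True)" "xca_rej ?A = encode_view (Halted False)"
    by (simp_all add: tm_xca_def)
  ultimately show "\<exists>t\<le>2 * T (length w) + 2.
     (xca_dec ?A w t = xca_acc ?A \<or> xca_dec ?A w t = xca_rej ?A) \<and>
     (\<forall>t'<t. xca_dec ?A w t' \<noteq> xca_acc ?A \<and> xca_dec ?A w t' \<noteq> xca_rej ?A) \<and>
     (xca_dec ?A w t = xca_acc ?A \<longleftrightarrow> w \<in> L)"
    using gt pre
    by (intro exI[of _ t]) (auto simp: dec_eq enc)
qed

lemma class_P_subset_1XCAP: "(class_P :: ('a::finite) list set set) \<subseteq> class_1XCAP"
proof
  fix L :: "'a list set"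
  assume "L \<in> class_P"
  then obtain M c k where M: "tm_wf M" "tm_decides_in_time M L (\<lambda>n. c * n ^ k + c)"
    by (auto simp: class_P_def)
  have "2 * (c * n ^ k + c) + 2 \<le> (2 * c + 2) * n ^ k + (2 * c + 2)" for n
    by (simp add: algebra_simps)
  then have "xca_decides_in_time (tm_xca M) L (\<lambda>n. (2 * c + 2) * n ^ k + (2 * c + 2))"
    using tm_xca_decides[OF M] unfolding xca_decides_in_time_def
    by (meson order_trans)
  then show "L \<in> class_1XCAP"
    using tm_xca_wf[OF M(1)] unfolding class_1XCAP_def by blast
qed

section \<open>Sweeping machines\<close>

text \<open>One pass of a Mealy machine; a right-to-left pass is a sweep over the reversed
  list.\<close>

fun sweep :: "('s \<Rightarrow> 'g \<Rightarrow> 's \<times> 'g) \<Rightarrow> 's \<Rightarrow> 'g list \<Rightarrow> 's \<times> 'g list" where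
  "sweep f s [] = (s, [])"
| "sweep f s (x # xs) = (let (s', y) = f s x; (s'', ys) = sweep f s' xs in (s'', y # ys))"

lemma sweep_append:
  "sweep f s (xs @ ys) =
     (let (s', xs') = sweep f s xs; (s'', ys') = sweep f s' ys in (s'', xs' @ ys'))"
  by (induction xs arbitrary: s) (auto split: prod.splits)

lemma length_sweep [simp]: "length (snd (sweep f s xs)) = length xs"
  by (induction xs arbitrary: s) (auto split: prod.splits, metis snd_conv)

text \<open>\<open>right_end\<close> may append one letter, the only way in which the tape grows;
  \<open>left_end\<close> either starts the next round or stops with a verdict.\<close>

record ('s, 'g) sweeper =
  right_rule :: "'s \<Rightarrow> 'g \<Rightarrow> 's \<times> 'g"
  right_end :: "'s \<Rightarrow> 's \<times> 'g option"
  left_rule :: "'s \<Rightarrow> 'g \<Rightarrow> 's \<times> 'g"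
  left_end :: "'s \<Rightarrow> 's + bool"

definition sweep_round :: "('s, 'g) sweeper \<Rightarrow> 's \<times> 'g list \<Rightarrow> ('s \<times> 'g list) + bool" where
  "sweep_round W c =
     (let (s1, ys) = sweep (right_rule W) (fst c) (snd c);
          (s2, a) = right_end W s1;
          (s3, zs) = sweep (left_rule W) s2 (rev (ys @ (case a of None \<Rightarrow> [] | Some x \<Rightarrow> [x])))
      in case left_end W s3 of Inl s \<Rightarrow> Inl (s, rev zs) | Inr b \<Rightarrow> Inr b)"

fun sweep_halts :: "('s, 'g) sweeper \<Rightarrow> nat \<Rightarrow> bool \<Rightarrow> ('s \<times> 'g list) + bool \<Rightarrow> bool" where
  "sweep_halts W n b (Inr b') \<longleftrightarrow> b = b'"
| "sweep_halts W 0 b (Inl c) \<longleftrightarrow> False"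
| "sweep_halts W (Suc n) b (Inl c) \<longleftrightarrow> sweep_halts W n b (sweep_round W c)"

lemma sweep_halts_mono: "sweep_halts W n b r \<Longrightarrow> n \<le> m \<Longrightarrow> sweep_halts W m b r"
proof (induction W n b r arbitrary: m rule: sweep_halts.induct)
  case (3 W n b c)
  then show ?case by (cases m) auto
qed auto

locale sweeper_tm =
  fixes W :: "('s::countable, 'g::countable) sweeper"
    and S :: "'s set" and G :: "'g set" and s0 :: 's and emb :: "'a::finite \<Rightarrow> 'g"
  assumes fin: "finite S" "finite G"
    and emb: "inj emb" "range emb \<subseteq> G" and s0: "s0 \<in> S"
    and rr: "\<And>s x. s \<in> S \<Longrightarrow> x \<in> G \<Longrightarrow> right_rule W s x \<in> S \<times> G"
    and lr: "\<And>s x. s \<in> S \<Longrightarrow> x \<in> G \<Longrightarrow> left_rule W s x \<in> S \<times> G"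
    and re: "\<And>s. s \<in> S \<Longrightarrow> right_end W s \<in> S \<times> insert None (Some ` G)"
    and le: "\<And>s. s \<in> S \<Longrightarrow> left_end W s \<in> Inl ` S \<union> range Inr"
begin

text \<open>\<open>tm_init\<close> writes \<open>Inl a\<close>, so the letters in the range of
  \<open>emb\<close> must have these codes; \<open>Suc\<close> keeps \<open>Inr 0\<close> free for
  the blank that marks both ends of the tape.\<close>

definition enc :: "'g \<Rightarrow> 'a + nat" where
  "enc g = (if g \<in> range emb then Inl (inv emb g) else Inr (Suc (to_nat g)))"

definition dec :: "'a + nat \<Rightarrow> 'g" where
  "dec y = (case y of Inl a \<Rightarrow> emb a | Inr k \<Rightarrow> from_nat (k - 1))"

lemma dec_enc [simp]: "dec (enc g) = g"
  by (auto simp: dec_def enc_def inv_f_f[OF emb(1)])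

lemma enc_emb [simp]: "enc (emb a) = Inl a"
  using emb(1) by (auto simp: enc_def)

lemma enc_not_blank [simp]: "enc g \<noteq> Inr 0"
  by (auto simp: enc_def)

definition right_state :: "'s \<Rightarrow> nat" where
  "right_state s = to_nat (Inl (True, s) :: (bool \<times> 's) + bool)"

definition left_state :: "'s \<Rightarrow> nat" where
  "left_state s = to_nat (Inl (False, s) :: (bool \<times> 's) + bool)"

definition verdict_state :: "bool \<Rightarrow> nat" where
  "verdict_state b = to_nat (Inr b :: (bool \<times> 's) + bool)"

text \<open>After appending a letter the head stays in place, because the left sweep starts on that
  letter; otherwise it steps back from the blank. At the left end it returns from position
  \<open>-1\<close> to \<open>0\<close>.\<close>

definition machine :: "'a tm" where
  "machine = \<lparr>
    tm_states = right_state ` S \<union> left_state ` S \<union> range verdict_state,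
    tm_syms = insert (Inr 0) (enc ` G),
    tm_blank = Inr 0,
    tm_delta = (\<lambda>p y. case (from_nat p :: (bool \<times> 's) + bool) of
       Inl (True, s) \<Rightarrow>
         if y = Inr 0 then
           (case right_end W s of
              (s', None) \<Rightarrow> (left_state s', Inr 0, -1)
            | (s', Some g) \<Rightarrow> (left_state s', enc g, 0))
         else (case right_rule W s (dec y) of (s', g) \<Rightarrow> (right_state s', enc g, 1))
     | Inl (False, s) \<Rightarrow>
         if y = Inr 0 then
           (case left_end W s of
              Inl s' \<Rightarrow> (right_state s', Inr 0, 1)
            | Inr b \<Rightarrow> (verdict_state b, Inr 0, 0))
         else (case left_rule W s (dec y) of (s', g) \<Rightarrow> (left_state s', enc g, -1))
     | Inr b \<Rightarrow> (p, y, 0)),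
    tm_start = right_state s0,
    tm_acc = verdict_state True,
    tm_rej = verdict_state False\<rparr>"

lemma machine_wf: "tm_wf machine"
proof -
  have sub: "range Inl \<subseteq> enc ` G"
    using emb(2) by (metis (no_types, lifting) enc_emb image_iff image_subset_iff rangeE subsetI rangeI)
  have "fst (tm_delta machine p x) \<in> tm_states machine \<and>
        fst (snd (tm_delta machine p x)) \<in> tm_syms machine \<and>
        snd (snd (tm_delta machine p x)) \<in> {-1, 0, 1}"
    if "p \<in> tm_states machine" "x \<in> tm_syms machine" for p x
  proof -
    have p: "p \<in> right_state ` S \<union> left_state ` S \<union> range verdict_state"
      using that(1) by (simp add: machine_def)
    have x: "x = Inr 0 \<or> (\<exists>g\<in>G. x = enc g)"
      using that(2) by (auto simp: machine_def)
    from p consider s where "s \<in> S" "p = right_state s" | s where "s \<in> S" "p = left_state s"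
      | b where "p = verdict_state b" by blast
    then show ?thesis
    proof cases
      case 1
      then show ?thesis using x rr[of s] re[of s]
        by (fastforce simp: machine_def right_state_def split: prod.splits option.splits)
    next
      case 2
      then show ?thesis using x lr[of s] le[of s]
        by (fastforce simp: machine_def left_state_def split: prod.splits sum.splits)
    next
      case 3
      then show ?thesis using that by (auto simp: machine_def verdict_state_def)
    qed
  qed
  moreover have "finite (tm_states machine)" "finite (tm_syms machine)"
    using fin by (simp_all add: machine_def)
  moreover have "verdict_state True \<noteq> verdict_state False"
    by (simp add: verdict_state_def)
  ultimately show ?thesis
    using sub s0 unfolding tm_wf_def by (auto simp: machine_def)
qed

definition tape_of :: "'g list \<Rightarrow> int \<Rightarrow> 'a + nat" where
  "tape_of xs i = (if 0 \<le> i \<and> i < int (length xs) then enc (xs ! nat i) else Inr 0)"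

lemma tape_of_at [simp]: "tape_of (ys @ x # xs) (int (length ys)) = enc x"
  by (simp add: tape_of_def)

lemma tape_of_end [simp]: "tape_of ys (int (length ys)) = Inr 0" "tape_of ys (-1) = Inr 0"
  by (simp_all add: tape_of_def)

lemma tape_of_upd [simp]:
  "(tape_of (ys @ x # xs))(int (length ys) := enc y) = tape_of (ys @ y # xs)"
  by (rule ext) (auto simp: tape_of_def nth_append nth_Cons' nat_less_iff zless_nat_eq_int_zless)

lemma tape_of_extend [simp]: "(tape_of ys)(int (length ys) := enc y) = tape_of (ys @ [y])"
  by (rule ext) (auto simp: tape_of_def nth_append nat_less_iff zless_nat_eq_int_zless)

lemma tape_of_blank [simp]:
  "(tape_of ys)(int (length ys) := Inr 0) = tape_of ys" "(tape_of ys)(-1 := Inr 0) = tape_of ys"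
  by (rule ext, simp add: tape_of_def)+

lemma state_not_halting [simp]:
  "right_state s \<noteq> verdict_state b" "left_state s \<noteq> verdict_state b"
  by (simp_all add: right_state_def left_state_def verdict_state_def)

lemma step_right:
  assumes "right_rule W s x = (s', y)"
  shows "tm_step machine (right_state s, tape_of (ys @ x # xs), int (length ys)) =
    (right_state s', tape_of (ys @ y # xs), int (length ys) + 1)"
  using assms by (simp add: tm_step_def machine_def) (simp add: right_state_def)

lemma step_left:
  assumes "left_rule W s x = (s', y)"
  shows "tm_step machine (left_state s, tape_of (ys @ x # xs), int (length ys)) =
    (left_state s', tape_of (ys @ y # xs), int (length ys) - 1)"
  using assms by (simp add: tm_step_def machine_def) (simp add: left_state_def)

text \<open>\<open>ys\<close> is the part already rewritten; it has to be general because it grows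
  during the induction.\<close>

lemma run_right:
  assumes "sweep (right_rule W) s xs = (s', zs)"
  shows "(tm_step machine ^^ length xs) (right_state s, tape_of (ys @ xs), int (length ys)) =
    (right_state s', tape_of (ys @ zs), int (length ys + length xs))"
  using assms
proof (induction xs arbitrary: s ys zs)
  case (Cons x xs)
  obtain s1 y where 1: "right_rule W s x = (s1, y)" by fastforce
  obtain zs' where 2: "sweep (right_rule W) s1 xs = (s', zs')" "zs = y # zs'"
    using Cons.prems 1 by (auto split: prod.splits)
  show ?case
    using Cons.IH[OF 2(1), of "ys @ [y]"] step_right[OF 1, of ys xs]
    by (simp add: funpow_swap1 2(2) add.commute del: funpow.simps(2) add: funpow_Suc_right)
qed simp

lemma run_left:
  assumes "sweep (left_rule W) s (rev xs) = (s', zs)"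
  shows "(tm_step machine ^^ length xs) (left_state s, tape_of (xs @ ys), int (length xs) - 1) =
    (left_state s', tape_of (rev zs @ ys), -1)"
  using assms
proof (induction xs arbitrary: s ys zs rule: rev_induct)
  case (snoc x xs)
  obtain s1 y where 1: "left_rule W s x = (s1, y)" by fastforce
  obtain zs' where 2: "sweep (left_rule W) s1 (rev xs) = (s', zs')" "zs = y # zs'"
    using snoc.prems 1 by (auto split: prod.splits)
  show ?case
    using snoc.IH[OF 2(1), of "y # ys"] step_left[OF 1, of xs ys]
    by (simp add: 2(2) del: funpow.simps(2) add: funpow_Suc_right)
qed simp

text \<open>The bound is \<open>length xs\<close> for the right sweep, one step to turn, at most
  \<open>length xs + 1\<close> for the left sweep, and one step to turn again.\<close>

lemma run_round:
  fixes s :: 's and xs :: "'g list"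
  defines "r \<equiv> sweep_round W (s, xs)"
  shows "\<exists>n \<le> 2 * length xs + 3. case r of
     Inl (s', zs) \<Rightarrow> length zs \<le> Suc (length xs) \<and>
       (tm_step machine ^^ n) (right_state s, tape_of xs, 0) = (right_state s', tape_of zs, 0)
   | Inr b \<Rightarrow> fst ((tm_step machine ^^ n) (right_state s, tape_of xs, 0)) = verdict_state b"
proof -
  obtain s1 ys where 1: "sweep (right_rule W) s xs = (s1, ys)" by fastforce
  have ys: "length ys = length xs" using length_sweep[of "right_rule W" s xs] by (simp add: 1)
  obtain s2 a where 2: "right_end W s1 = (s2, a)" by fastforce
  define ys' where "ys' = ys @ (case a of None \<Rightarrow> [] | Some x \<Rightarrow> [x])"
  have ys': "length ys' \<le> Suc (length xs)" by (simp add: ys'_def ys split: option.split)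
  obtain s3 zs where 3: "sweep (left_rule W) s2 (rev ys') = (s3, zs)" by fastforce
  have zs: "length zs = length ys'" using length_sweep[of "left_rule W" s2 "rev ys'"] by (simp add: 3)
  have r: "r = (case left_end W s3 of Inl s \<Rightarrow> Inl (s, rev zs) | Inr b \<Rightarrow> Inr b)"
    using 3 by (simp add: r_def sweep_round_def 1 2 ys'_def)
  define c where "c = (right_state s, tape_of xs, 0 :: int)"
  have "(tm_step machine ^^ length xs) c = (right_state s1, tape_of ys, int (length ys))"
    using run_right[OF 1, of "[]"] ys by (simp add: c_def)
  moreover have "tm_step machine (right_state s1, tape_of ys, int (length ys)) =
     (left_state s2, tape_of ys', int (length ys') - 1)"
    using 2 by (cases a; simp add: tm_step_def machine_def; simp add: right_state_def ys'_def)
  ultimately have "(tm_step machine ^^ Suc (length xs)) c = (left_state s2, tape_of ys', int (length ys') - 1)"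
    by simp
  then have "(tm_step machine ^^ (length ys' + Suc (length xs))) c = (left_state s3, tape_of (rev zs), -1)"
    using run_left[OF 3, of "[]"] by (simp only: funpow_add o_apply append_Nil2)
  then have *: "(tm_step machine ^^ Suc (length ys' + Suc (length xs))) c =
      tm_step machine (left_state s3, tape_of (rev zs), -1)"
    by (simp only: funpow.simps o_apply)
  \<comment> \<open>The pattern variable \<open>zs\<close> shadows the outer list, so
    \<open>zs'\<close> brings that list into the statement.\<close>
  have "case r of
     Inl (s', zs) \<Rightarrow> length zs \<le> Suc (length xs) \<and>
       tm_step machine (left_state s3, tape_of (rev zs'), -1) = (right_state s', tape_of zs, 0)
   | Inr b \<Rightarrow> fst (tm_step machine (left_state s3, tape_of (rev zs'), -1)) = verdict_state b"
    if "zs' = zs" for zs'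
    using zs ys' that
    by (cases "left_end W s3"; simp add: r tm_step_def machine_def; simp add: left_state_def)
  then show ?thesis
    using ys' * by (intro exI[of _ "Suc (length ys' + Suc (length xs))"]) (simp only: c_def, simp)
qed

text \<open>Each round lengthens the tape by at most one letter, so within \<open>n\<close> rounds
  no sweep is longer than \<open>length xs + n\<close>.\<close>

lemma run_halts:
  assumes "sweep_halts W n b (Inl (s, xs))"
  shows "\<exists>m \<le> n * (2 * (length xs + n) + 3).
    fst ((tm_step machine ^^ m) (right_state s, tape_of xs, 0)) = verdict_state b"
  using assms
proof (induction n arbitrary: s xs)
  case (Suc n)
  obtain k where k: "k \<le> 2 * length xs + 3"
    "case sweep_round W (s, xs) of
     Inl (s', zs) \<Rightarrow> length zs \<le> Suc (length xs) \<and>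
       (tm_step machine ^^ k) (right_state s, tape_of xs, 0) = (right_state s', tape_of zs, 0)
   | Inr b \<Rightarrow> fst ((tm_step machine ^^ k) (right_state s, tape_of xs, 0)) = verdict_state b"
    using run_round[where s = s and xs = xs] by blast
  show ?case
  proof (cases "sweep_round W (s, xs)")
    case (Inr b')
    then show ?thesis using k Suc.prems by (intro exI[of _ k]) auto
  next
    case (Inl c)
    obtain s' zs where c: "c = (s', zs)" by fastforce
    have zs: "length zs \<le> Suc (length xs)"
      "(tm_step machine ^^ k) (right_state s, tape_of xs, 0) = (right_state s', tape_of zs, 0)"
      using k Inl c by auto
    obtain m where m: "m \<le> n * (2 * (length zs + n) + 3)"
      "fst ((tm_step machine ^^ m) (right_state s', tape_of zs, 0)) = verdict_state b"
      using Suc.IH[of s' zs] Suc.prems Inl c by auto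
    have "n * (2 * (length zs + n) + 3) \<le> n * (2 * (length xs + Suc n) + 3)"
      using zs(1) by (intro mult_le_mono) auto
    then have "m \<le> n * (2 * (length xs + Suc n) + 3)"
      using m(1) by (rule order_trans[rotated])
    then have "m + k \<le> Suc n * (2 * (length xs + Suc n) + 3)"
      unfolding mult_Suc using k(1) by (subst add.commute, intro add_mono) auto
    then show ?thesis
      using m(2) zs(2) by (intro exI[of _ "m + k"]) (simp add: funpow_add)
  qed
qed simp

lemma machine_decides:
  assumes "\<And>w. sweep_halts W (K (length w)) (w \<in> L) (Inl (s0, map emb w))"
  shows "tm_decides_in_time machine L (\<lambda>n. K n * (2 * (n + K n) + 3))"
  unfolding tm_decides_in_time_def
proof
  fix w
  have "tm_init machine w = (right_state s0, tape_of (map emb w), 0)"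
    by (auto simp: tm_init_def machine_def tape_of_def fun_eq_iff)
  then obtain m where m: "m \<le> K (length w) * (2 * (length w + K (length w)) + 3)"
    "fst (tm_run machine w m) = verdict_state (w \<in> L)"
    using run_halts[OF assms[of w]] by (auto simp: tm_run_def)
  have "tm_acc machine = verdict_state True" "tm_rej machine = verdict_state False"
    "verdict_state True \<noteq> verdict_state False"
    by (simp_all add: machine_def verdict_state_def)
  then show "\<exists>t\<le>K (length w) * (2 * (length w + K (length w)) + 3).
       (fst (tm_run machine w t) = tm_acc machine \<or> fst (tm_run machine w t) = tm_rej machine) \<and>
       (fst (tm_run machine w t) = tm_acc machine) = (w \<in> L)"
    using m by (intro exI[of _ m]) (cases "w \<in> L"; simp)
qed

end

section \<open>Polynomial bounds\<close>

definition poly_bounded :: "(nat \<Rightarrow> nat) \<Rightarrow> bool" where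
  "poly_bounded f \<longleftrightarrow> (\<exists>c k. \<forall>n. f n \<le> c * n ^ k + c)"

text \<open>The summand \<open>1\<close> covers \<open>n = 0\<close>, where \<open>0 ^ 0 = 1\<close>
  may exceed \<open>0 ^ l\<close>.\<close>

lemma power_le_power_add: "(n::nat) ^ k \<le> n ^ (k + l) + 1"
  by (cases "n = 0") (auto simp: power_add power_0_left intro!: le_SucI)

lemma poly_bounded_const: "poly_bounded (\<lambda>_. c)"
  unfolding poly_bounded_def by (meson le_add2)

lemma poly_bounded_id: "poly_bounded (\<lambda>n. n)"
  unfolding poly_bounded_def by (intro exI[of _ 1]) auto

lemma poly_bounded_add:
  assumes "poly_bounded f" "poly_bounded g"
  shows "poly_bounded (\<lambda>n. f n + g n)"
proof -
  obtain c k d l where f: "\<And>n. f n \<le> c * n ^ k + c" and g: "\<And>n. g n \<le> d * n ^ l + d"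
    using assms unfolding poly_bounded_def by metis
  have "f n + g n \<le> (2 * c + 2 * d) * n ^ (k + l) + (2 * c + 2 * d)" for n
  proof -
    have "c * n ^ k \<le> c * (n ^ (k + l) + 1)"
      by (intro mult_le_mono2 power_le_power_add)
    moreover have "d * n ^ l \<le> d * (n ^ (k + l) + 1)"
      using power_le_power_add[of n l k] by (intro mult_le_mono2) (simp add: add.commute)
    ultimately show ?thesis using f[of n] g[of n] by (simp add: algebra_simps)
  qed
  then show ?thesis unfolding poly_bounded_def by blast
qed

lemma poly_bounded_mult:
  assumes "poly_bounded f" "poly_bounded g"
  shows "poly_bounded (\<lambda>n. f n * g n)"
proof -
  obtain c k d l where f: "\<And>n. f n \<le> c * n ^ k + c" and g: "\<And>n. g n \<le> d * n ^ l + d"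
    using assms unfolding poly_bounded_def by metis
  have "f n * g n \<le> (4 * c * d) * n ^ (k + l) + (4 * c * d)" for n
  proof -
    have "f n * g n \<le> (c * n ^ k + c) * (d * n ^ l + d)"
      by (intro mult_le_mono f g)
    also have "\<dots> = (c * d) * (n ^ (k + l) + n ^ k + n ^ l + 1)"
      by (simp add: algebra_simps power_add)
    \<comment> \<open>Each of the four monomials is at most \<open>n ^ (k + l) + 1\<close>.\<close>
    also have "\<dots> \<le> (c * d) * (4 * n ^ (k + l) + 4)"
      using power_le_power_add[of n l k] power_le_power_add[of n k l]
      by (intro mult_le_mono2) (simp add: add.commute)
    finally show ?thesis by (simp add: algebra_simps)
  qed
  then show ?thesis unfolding poly_bounded_def by blast
qed

lemma class_P_I:
  assumes "tm_wf M" "tm_decides_in_time M L T" "poly_bounded T"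
  shows "L \<in> class_P"
proof -
  obtain c k where "\<And>n. T n \<le> c * n ^ k + c"
    using assms(3) by (auto simp: poly_bounded_def)
  then have "tm_decides_in_time M L (\<lambda>n. c * n ^ k + c)"
    using assms(2) unfolding tm_decides_in_time_def by (meson order_trans)
  then show ?thesis using assms(1) by (auto simp: class_P_def)
qed

section \<open>The two halves of a configuration\<close>

text \<open>The default is what lies beyond the end of the list: the quiescent state for half-lines,
  \<open>None\<close> for windows.\<close>

fun hd_or :: "'b \<Rightarrow> 'b list \<Rightarrow> 'b" where
  "hd_or z [] = z"
| "hd_or z (x # xs) = x"

lemma hd_or_replicate [simp]: "hd_or x (replicate m x) = x"
  by (cases m) auto

lemma hd_or_snoc [simp]: "hd_or x (xs @ [x]) = hd_or x xs"
  by (cases xs) auto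

definition revealed :: "('b \<Rightarrow> 'b \<Rightarrow> 'b \<Rightarrow> 'b) \<Rightarrow> 'b \<Rightarrow> 'b \<Rightarrow> 'b \<Rightarrow> 'b list" where
  "revealed D h x y = (if D x h y = h then [] else [D x h y])"

text \<open>The half-line to the left of a cell is handled by reversing the list and flipping the local
  rule.\<close>

fun grow :: "('b \<Rightarrow> 'b \<Rightarrow> 'b \<Rightarrow> 'b) \<Rightarrow> 'b \<Rightarrow> 'b \<Rightarrow> 'b \<Rightarrow> 'b list \<Rightarrow> 'b list" where
  "grow D q h p [] = []"
| "grow D q h p (x # xs) =
     D p x (hd_or q xs) # revealed D h x (hd_or q xs) @ grow D q h x xs"

abbreviation (input) flip_rule :: "('b \<Rightarrow> 'b \<Rightarrow> 'b \<Rightarrow> 'b) \<Rightarrow> 'b \<Rightarrow> 'b \<Rightarrow> 'b \<Rightarrow> 'b" where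
  "flip_rule D \<equiv> \<lambda>x y z. D z y x"

lemma xca_wf_q:
  assumes "xca_wf A"
  shows "xca_q A \<in> xca_states A" "xca_q A \<noteq> xca_hid A" "xca_hid A \<in> xca_states A"
    "xca_delta A (xca_q A) (xca_hid A) (xca_q A) = xca_hid A"
    "xca_delta A (xca_q A) (xca_q A) (xca_q A) = xca_q A"
  using assms unfolding xca_wf_def by simp_all

lemma xca_wf_delta:
  assumes "xca_wf A" "x \<in> xca_states A" "y \<in> xca_states A" "z \<in> xca_states A"
  shows "xca_delta A x y z \<in> xca_states A" "y \<noteq> xca_hid A \<Longrightarrow> xca_delta A x y z \<noteq> xca_hid A"
proof -
  have "\<forall>x\<in>xca_states A. \<forall>y\<in>xca_states A. \<forall>z\<in>xca_states A.
      xca_delta A x y z \<in> xca_states A \<and>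
      (xca_delta A x y z = xca_hid A \<longrightarrow> y = xca_hid A) \<and>
      (y \<noteq> xca_q A \<and> y \<noteq> xca_hid A \<longrightarrow> xca_delta A x y z \<noteq> xca_q A)"
    using assms(1) unfolding xca_wf_def by (elim conjE)
  from bspec[OF bspec[OF bspec[OF this assms(2)] assms(3)] assms(4)]
  show "xca_delta A x y z \<in> xca_states A" "y \<noteq> xca_hid A \<Longrightarrow> xca_delta A x y z \<noteq> xca_hid A"
    by auto
qed

text \<open>Both halves begin with the decision cell, whose missing neighbour comes from the other
  half. A hidden cell belongs to the half in which it lies and is listed behind its inner visible
  neighbour. The appended \<open>q\<close> is the one outer cell that can become active; behind it
  nothing is revealed, because a hidden cell between quiescent cells stays hidden.\<close>

lemma xca_step_halves:
  assumes wf: "xca_wf A" and c: "set c \<subseteq> xca_states A - {xca_hid A}" and d: "d < length c"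
    and step: "xca_step A (c, d) = (c', d')"
  shows "set c' \<subseteq> xca_states A - {xca_hid A}" "d' < length c'"
    "drop d' c' = grow (xca_delta A) (xca_q A) (xca_hid A)
       (hd_or (xca_q A) (tl (rev (take (Suc d) c)))) (drop d c @ [xca_q A])"
    "rev (take (Suc d') c') = grow (flip_rule (xca_delta A)) (xca_q A) (xca_hid A)
       (hd_or (xca_q A) (tl (drop d c))) (rev (take (Suc d) c) @ [xca_q A])"
proof -
  let ?q = "xca_q A" and ?h = "xca_hid A" and ?D = "xca_delta A"
  let ?F = "filter (\<lambda>s. s \<noteq> ?h)"
  define e where "e = [?q] @ c @ [?q]"
  define n where "n = length e"
  have n: "n = length c + 2" by (simp add: n_def e_def)
  define v where "v = (\<lambda>i::nat. ?D (cell_at A e (int i - 1)) (e ! i) (cell_at A e (int i + 1)))"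
  define h where "h = (\<lambda>i::nat. ?D (e ! i) ?h (e ! (i + 1)))"
  define inter where "inter = concat (map (\<lambda>i. [v i, h i]) [0..<n - 1]) @ [v (n - 1)]"
  have st: "c' = ?F inter" "d' = length (?F (take (2 * (d + 1)) inter))"
  proof -
    have "xca_step A (c, d) = (?F inter, length (?F (take (2 * (d + 1)) inter)))"
      by (simp only: xca_step_def Let_def split inter_def h_def v_def e_def n_def)
    then show "c' = ?F inter" "d' = length (?F (take (2 * (d + 1)) inter))"
      unfolding step by blast+
  qed
  note q = xca_wf_q(1-4)[OF wf] and D = xca_wf_delta(1)[OF wf] and D_hid = xca_wf_delta(2)[OF wf]
  have e: "set e \<subseteq> xca_states A - {?h}" using c q by (auto simp: e_def)
  have ei: "e ! i \<in> xca_states A - {?h}" if "i < n" for i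
    using that e nth_mem[of i e] unfolding n_def by blast
  have ce: "cell_at A e i \<in> xca_states A" for i
    using ei q by (auto simp: cell_at_def n_def)
  have v: "v i \<in> xca_states A - {?h}" if "i < n" for i
    using D[OF ce _ ce] D_hid[OF ce _ ce] ei[OF that] unfolding v_def by blast
  have hh: "h i \<in> xca_states A" if "i + 1 < n" for i
    unfolding h_def using ei[of i] ei[of "i + 1"] that q by (intro D) auto
  have inter_states: "set inter \<subseteq> xca_states A"
    using v hh n by (auto simp: inter_def)
  then show "set c' \<subseteq> xca_states A - {?h}" by (auto simp: st)
  have last_e: "e ! (n - 1) = ?q" by (simp add: n e_def nth_append)
  \<comment> \<open>Downward induction on \<open>k\<close>, matching the recursion of
    \<open>grow\<close> along the suffixes of \<open>e\<close>.\<close>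
  have right: "?F (concat (map (\<lambda>i. [v i, h i]) [k..<n - 1]) @ [v (n - 1)]) =
      grow ?D ?q ?h (cell_at A e (int k - 1)) (drop k e)" if "k \<le> n - 1" for k
    using that
  proof (induction k rule: inc_induct)
    case base
    have "drop (n - 1) e = [?q]"
      by (simp add: n e_def)
    moreover have "cell_at A e (int (n - 1) + 1) = ?q" using n by (auto simp: cell_at_def n_def)
    ultimately show ?case
      using v[of "n - 1"] n q last_e by (simp add: v_def revealed_def)
  next
    case (step k)
    have k: "k < n" "Suc k < n" using step n by auto
    have dk: "drop k e = e ! k # drop (Suc k) e" "drop (Suc k) e = e ! Suc k # drop (Suc (Suc k)) e"
      using k by (simp_all add: Cons_nth_drop_Suc n_def)
    have "[k..<n - 1] = k # [Suc k..<n - 1]" using step by (simp add: upt_conv_Cons)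
    moreover have "cell_at A e (int (Suc k) - 1) = e ! k" "cell_at A e (int k + 1) = e ! Suc k"
      using k by (simp_all add: cell_at_def n_def nat_add_distrib)
    ultimately show ?case
      using step.IH v[OF k(1)] unfolding dk(1)
      by (simp add: dk(2) v_def h_def revealed_def)
  qed
  \<comment> \<open>Read backwards, the first \<open>k\<close> pairs begin with the hidden cell next
    to \<open>e ! k\<close>, but the visible cell \<open>e ! k\<close> is not among them; hence the
    separate \<open>revealed\<close> in front.\<close>
  have left: "rev (?F (concat (map (\<lambda>i. [v i, h i]) [0..<k]))) =
      revealed (flip_rule ?D) ?h (e ! k) (hd_or ?q (rev (take k e))) @
      grow (flip_rule ?D) ?q ?h (e ! k) (rev (take k e))" if "k < n" for k
    using that
  proof (induction k)
    case 0
    have "e ! 0 = ?q" by (simp add: e_def)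
    then show ?case using q by (simp add: revealed_def)
  next
    case (Suc k)
    have tk: "take (Suc k) e = take k e @ [e ! k]"
      using Suc.prems by (simp add: n_def take_Suc_conv_app_nth)
    have prev: "hd_or ?q (rev (take k e)) = cell_at A e (int k - 1)"
    proof (cases k)
      case (Suc j)
      then have "take k e = take j e @ [e ! j]"
        using \<open>Suc k < n\<close> by (simp add: n_def take_Suc_conv_app_nth)
      then show ?thesis using Suc \<open>Suc k < n\<close> by (simp add: cell_at_def n_def)
    qed (simp add: cell_at_def)
    have nxt: "cell_at A e (int k + 1) = e ! Suc k"
      using Suc.prems by (simp add: cell_at_def n_def nat_add_distrib)
    show ?case
      using Suc v[of k] by (simp add: tk prev nxt v_def h_def revealed_def)
  qed
  have "take (2 * (d + 1)) inter = concat (map (\<lambda>i. [v i, h i]) [0..<d + 1])"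
    unfolding inter_def by (rule take_interleave) (use d n in simp)
  then have take_inter: "take (2 * (d + 1)) inter = concat (map (\<lambda>i. [v i, h i]) [0..<Suc d])"
    by simp
  have "[0..<n - 1] = [0..<Suc d] @ [Suc d..<n - 1]"
    using upt_add_eq_append[of 0 "Suc d" "n - 1 - Suc d"] d n by (simp del: upt_Suc)
  then have split_inter: "inter = concat (map (\<lambda>i. [v i, h i]) [0..<Suc d]) @
      concat (map (\<lambda>i. [v i, h i]) [Suc d..<n - 1]) @ [v (n - 1)]"
    unfolding inter_def by (simp only: map_append concat_append append_assoc)
  define Lf where "Lf = ?F (concat (map (\<lambda>i. [v i, h i]) [0..<Suc d]))"
  define Rt where "Rt = ?F (concat (map (\<lambda>i. [v i, h i]) [Suc d..<n - 1]) @ [v (n - 1)])"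
  have c': "c' = Lf @ Rt"
    unfolding st(1) split_inter Lf_def Rt_def by (rule filter_append)
  have d': "d' = length Lf"
    by (simp only: st(2) take_inter Lf_def)
  have drop_e: "drop (Suc d) e = drop d c @ [?q]" using d by (simp add: e_def)
  have take_e: "take (Suc d) e = ?q # take d c" using d by (simp add: e_def)
  have e_Suc_d: "e ! Suc d = c ! d" using d by (simp add: e_def nth_append)
  have take_c: "take (Suc d) c = take d c @ [c ! d]" using d by (simp add: take_Suc_conv_app_nth)
  have drop_c: "drop d c = c ! d # drop (Suc d) c" using d by (simp add: Cons_nth_drop_Suc)
  have before: "cell_at A e (int (Suc d) - 1) = hd_or ?q (tl (rev (take (Suc d) c)))"
  proof (cases d)
    case 0
    then show ?thesis using d by (cases c) (simp_all add: cell_at_def e_def)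
  next
    case (Suc j)
    then have "take d c = take j c @ [c ! j]" using d by (simp add: take_Suc_conv_app_nth)
    then have "hd_or ?q (tl (rev (take (Suc d) c))) = c ! j" unfolding take_c by simp
    moreover have "e ! d = c ! j" using Suc d by (simp add: e_def nth_append)
    moreover have "int (Suc d) - 1 = int d" "d < length e" using d by (simp_all add: e_def)
    ultimately show ?thesis by (simp add: cell_at_def)
  qed
  have Rt: "Rt = grow ?D ?q ?h (hd_or ?q (tl (rev (take (Suc d) c)))) (drop d c @ [?q])"
    using right[of "Suc d"] d n unfolding Rt_def by (simp only: drop_e before)
  then show "drop d' c' = grow ?D ?q ?h (hd_or ?q (tl (rev (take (Suc d) c)))) (drop d c @ [?q])"
    by (simp add: c' d')
  have Rt_Cons: "Rt = ?D (hd_or ?q (tl (rev (take (Suc d) c)))) (c ! d) (hd_or ?q (drop (Suc d) c)) # tl Rt"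
    unfolding Rt drop_c by (cases "drop (Suc d) c") simp_all
  then obtain y ys where y: "Rt = y # ys"
    "y = ?D (hd_or ?q (tl (rev (take (Suc d) c)))) (c ! d) (hd_or ?q (drop (Suc d) c))" by blast
  then show "d' < length c'" by (simp add: c' d')
  have "rev (take (Suc d') c') = y # rev Lf" by (simp add: c' d' y(1))
  also have "\<dots> = grow (flip_rule ?D) ?q ?h (hd_or ?q (tl (drop d c))) (rev (take (Suc d) c) @ [?q])"
  proof -
    show ?thesis
      using left[of "Suc d"] d n unfolding Lf_def[symmetric] y(2)
      by (simp add: take_e e_Suc_d take_c drop_c)
  qed
  finally show "rev (take (Suc d') c') = grow (flip_rule ?D) ?q ?h (hd_or ?q (tl (drop d c)))
      (rev (take (Suc d) c) @ [?q])" .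
qed

section \<open>Half-lines known up to some distance\<close>

text \<open>The outermost known cell is lost because its new state depends on an unknown neighbour,
  and so does the hidden cell behind it.\<close>

fun known_grow :: "('b \<Rightarrow> 'b \<Rightarrow> 'b \<Rightarrow> 'b) \<Rightarrow> 'b \<Rightarrow> 'b \<Rightarrow> 'b list \<Rightarrow> 'b list" where
  "known_grow D h p [] = []"
| "known_grow D h p [x] = []"
| "known_grow D h p (x # y # zs) = D p x y # revealed D h x y @ known_grow D h x (y # zs)"

text \<open>A prefix relation in which \<open>xs\<close> continues with \<open>q\<close> forever, so
  that \<open>ks\<close> may be longer than \<open>xs\<close>.\<close>

fun agrees :: "'b \<Rightarrow> 'b list \<Rightarrow> 'b list \<Rightarrow> bool" where
  "agrees q [] xs = True"
| "agrees q (k # ks) xs \<longleftrightarrow> k = hd_or q xs \<and> agrees q ks (tl xs)"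

lemma agrees_append_same [simp]: "agrees q (zs @ ks) (zs @ xs) = agrees q ks xs"
  by (induction zs) auto

lemma agrees_quiescent [simp]: "agrees q ks [q] = agrees q ks []"
  by (cases ks) auto

lemma agrees_take: "agrees q ks xs \<Longrightarrow> agrees q (take m ks) xs"
proof (induction ks arbitrary: xs m)
  case (Cons k ks) then show ?case by (cases m) auto
qed simp

lemma agrees_replicate: "agrees q (replicate m q) []"
  by (induction m) auto

lemma agrees_known_grow:
  assumes "D q q q = q" "D q h q = h" "agrees q ks xs"
  shows "agrees q (known_grow D h p ks) (grow D q h p (xs @ [q]))"
  using assms(3)
proof (induction ks arbitrary: p xs)
  case (Cons x zs)
  note IH = Cons.IH and prems = Cons.prems
  show ?case
  proof (cases zs)
    case (Cons y zs')
    show ?thesis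
    proof (cases xs)
      case Nil
      \<comment> \<open>The first quiescent cell may still react to \<open>p\<close>; behind it all
        neighbourhoods are quiescent and yield only \<open>q\<close>.\<close>
      then have e: "x = q" "y = q" "agrees q zs []" using prems \<open>zs = y # zs'\<close> by auto
      have "agrees q (known_grow D h q zs) []"
        using IH[OF e(3), of q] assms(1,2) by (simp add: revealed_def)
      then show ?thesis using e Nil \<open>zs = y # zs'\<close> assms(2) by (simp add: revealed_def)
    next
      case (Cons x' xs')
      then have e: "x = x'" "y = hd_or q xs'" "agrees q zs xs'" using prems \<open>zs = y # zs'\<close> by auto
      have "hd_or q (xs' @ [q]) = y" using e(2) by (cases xs') auto
      then show ?thesis using IH[OF e(3), of x] e(1) Cons \<open>zs = y # zs'\<close> by simp
    qed
  qed simp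
qed simp

lemma length_known_grow: "length ks \<le> Suc (length (known_grow D h p ks))"
  by (induction D h p ks rule: known_grow.induct) auto

text \<open>In the bounded window that the Turing machine keeps, \<open>None\<close> stands for a cell whose state is
  no longer determined by the window.\<close>

fun opt_rule :: "('b \<Rightarrow> 'b \<Rightarrow> 'b \<Rightarrow> 'b) \<Rightarrow> 'b option \<Rightarrow> 'b option \<Rightarrow> 'b option \<Rightarrow> 'b option" where
  "opt_rule D (Some p) (Some x) (Some y) = Some (D p x y)"
| "opt_rule D _ _ _ = None"

fun opt_revealed :: "('b \<Rightarrow> 'b \<Rightarrow> 'b \<Rightarrow> 'b) \<Rightarrow> 'b \<Rightarrow> 'b option \<Rightarrow> 'b option \<Rightarrow> 'b option list" where
  "opt_revealed D h (Some x) (Some y) = map Some (revealed D h x y)"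
| "opt_revealed D h _ _ = []"

fun opt_grow :: "('b \<Rightarrow> 'b \<Rightarrow> 'b \<Rightarrow> 'b) \<Rightarrow> 'b \<Rightarrow> 'b option \<Rightarrow> 'b option list \<Rightarrow> 'b option list" where
  "opt_grow D h p [] = []"
| "opt_grow D h p (x # xs) =
     opt_rule D p x (hd_or None xs) # opt_revealed D h x (hd_or None xs) @ opt_grow D h x xs"

lemma opt_rule_None [simp]: "opt_rule D None x y = None" "opt_rule D p None y = None"
  "opt_rule D p x None = None"
  by (cases p; cases x; simp)+

lemma opt_revealed_None [simp]: "opt_revealed D h None y = []" "opt_revealed D h x None = []"
  by (cases x; simp)+

lemma length_opt_revealed: "length (opt_revealed D h x y) \<le> 1"
  by (cases x; cases y) (auto simp: revealed_def)

lemma opt_grow_None: "opt_grow D h p (replicate m None) = replicate m None"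
  by (induction m arbitrary: p) auto

text \<open>Next to an unknown cell nothing is revealed, so the unknown tail gains just the last
  known cell, which has become undetermined. The tail is padding and does not count actual
  cells.\<close>

lemma opt_grow_known:
  "opt_grow D h (Some p) (map Some ks @ replicate m None) =
     map Some (known_grow D h p ks) @ replicate (m + (if ks = [] then 0 else 1)) None"
  by (induction D h p ks rule: known_grow.induct) (simp_all add: opt_grow_None)

text \<open>The inequality expresses that at most one known cell is lost per step; in particular the
  decision cell is known while \<open>t < N\<close>.\<close>

definition window :: "'b \<Rightarrow> nat \<Rightarrow> nat \<Rightarrow> 'b list \<Rightarrow> 'b option list \<Rightarrow> bool" where
  "window q N t xs tr \<longleftrightarrow> length tr = N \<and>
     (\<exists>ks m. tr = map Some ks @ replicate m None \<and> agrees q ks xs \<and> N \<le> length ks + t)"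

text \<open>Cutting at \<open>N\<close> is harmless: either the known part fills the whole window,
  or it is not cut and has lost at most one cell.\<close>

lemma window_grow:
  assumes "D q q q = q" "D q h q = h" "window q N t xs tr"
  shows "window q N (Suc t) (grow D q h p (xs @ [q])) (take N (opt_grow D h (Some p) tr))"
proof -
  obtain ks m where k: "tr = map Some ks @ replicate m None" "agrees q ks xs" "N \<le> length ks + t"
    and "length tr = N"
    using assms(3) unfolding window_def by blast
  then have k4: "length ks + m = N" by simp
  define ks' where "ks' = known_grow D h p ks"
  define m' where "m' = m + (if ks = [] then 0 else 1 :: nat)"
  have len: "length ks \<le> Suc (length ks')" by (simp add: ks'_def length_known_grow)
  have "take N (opt_grow D h (Some p) tr) = map Some (take N ks') @ replicate (min (N - length ks') m') None"
    unfolding k(1) opt_grow_known ks'_def[symmetric] m'_def[symmetric] by (simp add: take_map)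
  moreover have "agrees q (take N ks') (grow D q h p (xs @ [q]))"
    unfolding ks'_def by (rule agrees_take[OF agrees_known_grow[where D = D, OF assms(1,2) k(2)]])
  moreover have "N \<le> length (take N ks') + Suc t" using len k(3) by simp
  moreover have "length (take N ks') + min (N - length ks') m' = N"
    using len k4 unfolding m'_def by (cases "ks = []") simp_all
  ultimately show ?thesis
    unfolding window_def
    by (intro conjI exI[of _ "take N ks'"] exI[of _ "min (N - length ks') m'"]) simp_all
qed

section \<open>Simulating an expanding automaton by sweeps\<close>

text \<open>Position \<open>j\<close> of the tape holds the initial state of cell \<open>j\<close> and the current
  states of the cells at distance \<open>j\<close> to the right and to the left of the decision cell.  Each of
  the two tracks consists of slots of one or two states: a second state is a revealed cell that
  still has to be moved to a slot of its own.  A slot is a list so that the contents of a track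
  are the concatenation of its slots; raw input has empty slots.\<close>

type_synonym 'v letter = "'v \<times> 'v option list \<times> 'v option list"

text \<open>Moving right, \<open>Init\<close> tells whether the first letter is still to come,
  \<open>Gather\<close> carries the states just passed, and \<open>Insert\<close> carries the slots
  being pushed outward. Moving left, \<open>Check\<close> remembers whether a double slot was seen
  and which right slot was read last, and \<open>Update\<close> carries the states of the outer
  neighbours.\<close>

datatype 'v phase =
    Init bool
  | Gather "('v option \<times> 'v option) option"
  | Insert "'v option list option" "'v option list option"
  | Verdict bool
  | Check bool "'v option list"
  | Update "'v option" "'v option"

instance phase :: (countable) countable
  by countable_datatype

abbreviation right_slot :: "'v letter \<Rightarrow> 'v option list" where
  "right_slot z \<equiv> fst (snd z)"

abbreviation left_slot :: "'v letter \<Rightarrow> 'v option list" where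
  "left_slot z \<equiv> snd (snd z)"

text \<open>Splits the first double slot and from there on shifts every slot by one place, so that
  the control carries a single slot. Whatever is carried at the end of the tape falls out of the
  window.\<close>

fun insert_slot :: "'b list option \<Rightarrow> 'b list \<Rightarrow> 'b list option \<times> 'b list" where
  "insert_slot None s = (if length s = 2 then (Some (drop 1 s), take 1 s) else (None, s))"
| "insert_slot (Some x) s = (Some s, x)"

lemma sweep_insert_slot_Some:
  "sweep insert_slot (Some x) ss = (Some (last (x # ss)), butlast (x # ss))"
  by (induction ss arbitrary: x) auto

text \<open>Nonempty slots contribute at least one entry each, so the first \<open>n\<close> entries
  already come from the first \<open>n\<close> slots.\<close>

lemma take_concat_butlast:
  assumes "\<forall>s \<in> set ys. s \<noteq> []" "length ys = Suc n"
  shows "take n (concat (butlast ys)) = take n (concat ys)"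
proof (cases ys rule: rev_cases)
  case (snoc zs z)
  have "length zs \<le> length (concat zs)" if "\<forall>s \<in> set zs. s \<noteq> []" for zs :: "'a list list"
    using that
  proof (induction zs)
    case (Cons z zs)
    then have "1 \<le> length z" by (cases z) auto
    then show ?case using Cons by simp
  qed simp
  from this[of zs] have "n \<le> length (concat zs)" using assms snoc by simp
  then show ?thesis using snoc by simp
qed (use assms in simp)

text \<open>The slot pushed out lies behind the first \<open>length ss\<close> entries. If the first
  \<open>k\<close> slots are single, the split occurs at index \<open>k\<close> or later and leaves
  a single slot in its place, hence \<open>Suc k\<close>.\<close>

lemma sweep_insert_slot:
  assumes "\<forall>s \<in> set ss. length s \<in> {1, 2}"
  defines "ss' \<equiv> snd (sweep insert_slot None ss)"
  shows "(\<forall>s \<in> set ss'. length s \<in> {1, 2}) \<and>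
    take (length ss) (concat ss') = take (length ss) (concat ss) \<and>
    ((\<forall>s \<in> set (take k ss). length s = 1) \<longrightarrow> (\<forall>s \<in> set (take (Suc k) ss'). length s = 1))"
  using assms(1) unfolding ss'_def
proof (induction ss arbitrary: k)
  case (Cons s ss)
  show ?case
  proof (cases "length s = 2")
    case True
    then obtain a b where s: "s = [a, b]" by (cases s; cases "tl s"; fastforce)
    have sw: "snd (sweep insert_slot None (s # ss)) = [a] # butlast ([b] # ss)"
      by (simp add: s sweep_insert_slot_Some del: last.simps butlast.simps)
    have ne: "\<forall>x \<in> set ([b] # ss). x \<noteq> []" using Cons.prems by auto
    have "take (length ss) (concat (butlast ([b] # ss))) = take (length ss) (b # concat ss)"
      using take_concat_butlast[OF ne] by simp
    moreover have "\<forall>x \<in> set (butlast ([b] # ss)). length x \<in> {1, 2}"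
      using Cons.prems by (auto dest!: in_set_butlastD)
    ultimately show ?thesis
      unfolding sw by (cases k) (simp_all add: s del: butlast.simps)
  next
    case False
    then have "length s = 1" using Cons.prems by simp
    then obtain a where s: "s = [a]" by (cases s) auto
    have sw: "snd (sweep insert_slot None (s # ss)) = s # snd (sweep insert_slot None ss)"
      by (simp add: s split: prod.splits)
    have IH: "(\<forall>s \<in> set (snd (sweep insert_slot None ss)). length s \<in> {1, 2}) \<and>
      take (length ss) (concat (snd (sweep insert_slot None ss))) = take (length ss) (concat ss) \<and>
      ((\<forall>s \<in> set (take j ss). length s = 1) \<longrightarrow>
        (\<forall>s \<in> set (take (Suc j) (snd (sweep insert_slot None ss))). length s = 1))" for j
      by (rule Cons.IH) (use Cons.prems in simp)
    show ?thesis
    proof (cases k)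
      case 0
      then show ?thesis using IH[of 0] unfolding sw by (simp add: s)
    next
      case (Suc j)
      then show ?thesis using IH[of j] unfolding sw by (simp add: s)
    qed
  qed
qed simp

text \<open>\<open>e\<close> is the answer for the empty word, about which
  \<open>xca_decides_in_time\<close> says nothing.\<close>

locale xca_simulation =
  fixes A :: "('a::finite) xca" and e :: bool
  assumes wf: "xca_wf A"
begin

abbreviation "q \<equiv> xca_q A"
abbreviation "h \<equiv> xca_hid A"
abbreviation "\<delta> \<equiv> xca_delta A"
abbreviation (input) "\<delta>' \<equiv> (\<lambda>x y z. xca_delta A z y x)"

text \<open>\<open>Gather\<close> puts in front of each state that of its inner neighbour, which the
  leftward sweep would meet too late; the first letter has none on its own track and keeps a slot of
  length one. In \<open>Init\<close> only the first letter, the decision cell, copies its symbol to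
  the left track.\<close>

fun rrule :: "('a + nat) phase \<Rightarrow> ('a + nat) letter \<Rightarrow> ('a + nat) phase \<times> ('a + nat) letter" where
  "rrule (Init b) (i, r, l) = (Init False, i, [Some i], [Some (if b then i else q)])"
| "rrule (Gather p) (i, r, l) = (Gather (Some (hd_or None r, hd_or None l)), i,
     (case p of None \<Rightarrow> [hd_or None r] | Some (a, b) \<Rightarrow> [a, hd_or None r]),
     (case p of None \<Rightarrow> [hd_or None l] | Some (a, b) \<Rightarrow> [b, hd_or None l]))"
| "rrule (Insert cr cl) (i, r, l) =
     (Insert (fst (insert_slot cr r)) (fst (insert_slot cl l)),
      i, snd (insert_slot cr r), snd (insert_slot cl l))"
| "rrule s z = (s, z)"

fun rend :: "('a + nat) phase \<Rightarrow> ('a + nat) phase \<times> ('a + nat) letter option" where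
  "rend (Init b) = (if b then (Verdict e, None) else (Check False [], Some (q, [Some q], [Some q])))"
| "rend (Gather p) = (Update None None, None)"
| "rend (Insert cr cl) = (Check False [], None)"
| "rend s = (s, None)"

text \<open>In \<open>Update\<close> a slot of length one marks the decision cell. Its inner
  neighbour on one track is the cell at distance one on the other track, whence the exchange of
  \<open>nl\<close> and \<open>nr\<close>.\<close>

fun lrule :: "('a + nat) phase \<Rightarrow> ('a + nat) letter \<Rightarrow> ('a + nat) phase \<times> ('a + nat) letter" where
  "lrule (Check b s) (i, r, l) = (Check (b \<or> length r = 2 \<or> length l = 2) r, i, r, l)"
| "lrule (Update nr nl) (i, r, l) =
     (let x = hd_or None (rev r); y = hd_or None (rev l);
          pr = (if length r = 1 then nl else hd_or None r);
          pl = (if length l = 1 then nr else hd_or None l)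
      in (Update x y, i, opt_rule \<delta> pr x nr # opt_revealed \<delta> h x nr,
            opt_rule \<delta>' pl y nl # opt_revealed \<delta>' h y nl))"
| "lrule s z = (s, z)"

fun lend :: "('a + nat) phase \<Rightarrow> ('a + nat) phase + bool" where
  "lend (Verdict b) = Inr b"
| "lend (Check b s) = (if b then Inl (Insert None None) else
     (case hd_or None s of None \<Rightarrow> Inl (Init True)
      | Some x \<Rightarrow> if x = xca_acc A then Inr True else if x = xca_rej A then Inr False
          else Inl (Gather None)))"
| "lend (Update x y) = Inl (Insert None None)"
| "lend s = Inl s"

definition W :: "(('a + nat) phase, ('a + nat) letter) sweeper" where
  "W = \<lparr>right_rule = rrule, right_end = rend, left_rule = lrule, left_end = lend\<rparr>"

section \<open>Finiteness and closure of the control states and tape letters\<close>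

definition vals :: "('a + nat) option set" where
  "vals = insert None (Some ` xca_states A)"

definition slots :: "('a + nat) option list set" where
  "slots = {s. set s \<subseteq> vals \<and> length s \<le> 2}"

definition letters :: "('a + nat) letter set" where
  "letters = xca_states A \<times> slots \<times> slots"

fun valid_phase :: "('a + nat) phase \<Rightarrow> bool" where
  "valid_phase (Gather p) \<longleftrightarrow> p \<in> insert None (Some ` (vals \<times> vals))"
| "valid_phase (Insert cr cl) \<longleftrightarrow> cr \<in> insert None (Some ` slots) \<and> cl \<in> insert None (Some ` slots)"
| "valid_phase (Check b s) \<longleftrightarrow> s \<in> slots"
| "valid_phase (Update x y) \<longleftrightarrow> x \<in> vals \<and> y \<in> vals"
| "valid_phase _ \<longleftrightarrow> True"

definition phases :: "('a + nat) phase set" where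
  "phases = Collect valid_phase"

lemma finite_phases:
  assumes "finite vals" "finite slots"
  shows "finite phases"
proof (rule finite_subset)
  let ?os = "insert None (Some ` slots)"
  show "phases \<subseteq> range Init \<union> Gather ` insert None (Some ` (vals \<times> vals)) \<union>
     case_prod Insert ` (?os \<times> ?os) \<union>
     range Verdict \<union> case_prod Check ` (UNIV \<times> slots) \<union>
     case_prod Update ` (vals \<times> vals)" (is "_ \<subseteq> ?B")
  proof
    fix s assume "s \<in> phases"
    then have s: "valid_phase s" by (simp add: phases_def)
    show "s \<in> ?B"
    proof (cases s)
      case (Insert cr cl)
      then have "s \<in> case_prod Insert ` (?os \<times> ?os)"
        using s by (intro image_eqI[of _ _ "(cr, cl)"]) auto
      then show ?thesis by blast
    next
      case (Check b x)
      then have "s \<in> case_prod Check ` (UNIV \<times> slots)"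
        using s by (intro image_eqI[of _ _ "(b, x)"]) simp_all
      then show ?thesis by blast
    next
      case (Update x y)
      then have "s \<in> case_prod Update ` (vals \<times> vals)"
        using s by (intro image_eqI[of _ _ "(x, y)"]) simp_all
      then show ?thesis by blast
    next
      case (Gather p)
      then have "s \<in> Gather ` insert None (Some ` (vals \<times> vals))"
        using s by (intro image_eqI[of _ _ p]) simp_all
      then show ?thesis by blast
    qed blast+
  qed
  show "finite ?B" using assms by simp
qed

lemma in_phases [simp]:
  "Init b \<in> phases" "Verdict b \<in> phases"
  "Gather None \<in> phases" "Gather (Some (x, y)) \<in> phases \<longleftrightarrow> x \<in> vals \<and> y \<in> vals"
  "Insert cr cl \<in> phases \<longleftrightarrow> cr \<in> insert None (Some ` slots) \<and> cl \<in> insert None (Some ` slots)"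
  "Check b s \<in> phases \<longleftrightarrow> s \<in> slots"
  "Update x y \<in> phases \<longleftrightarrow> x \<in> vals \<and> y \<in> vals"
  by (auto simp: phases_def)

lemma in_vals [simp]: "None \<in> vals" "Some x \<in> vals \<longleftrightarrow> x \<in> xca_states A"
  by (auto simp: vals_def)

lemma hd_or_vals: "s \<in> slots \<Longrightarrow> hd_or None s \<in> vals" "s \<in> slots \<Longrightarrow> hd_or None (rev s) \<in> vals"
proof -
  show "s \<in> slots \<Longrightarrow> hd_or None s \<in> vals" for s by (cases s) (auto simp: slots_def)
  from this[of "rev s"] show "s \<in> slots \<Longrightarrow> hd_or None (rev s) \<in> vals" by (auto simp: slots_def)
qed

lemma slots_intros: "x \<in> vals \<Longrightarrow> [x] \<in> slots" "x \<in> vals \<Longrightarrow> y \<in> vals \<Longrightarrow> [x, y] \<in> slots" "[] \<in> slots"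
  by (auto simp: slots_def)

lemma insert_slot_slots:
  assumes "s \<in> slots" "c \<in> insert None (Some ` slots)"
  shows "snd (insert_slot c s) \<in> slots" "fst (insert_slot c s) \<in> insert None (Some ` slots)"
proof -
  have "take 1 s \<in> slots" "drop 1 s \<in> slots"
    using assms(1) by (auto simp: slots_def dest: in_set_takeD in_set_dropD)
  then show "snd (insert_slot c s) \<in> slots" "fst (insert_slot c s) \<in> insert None (Some ` slots)"
    using assms by (cases c; auto)+
qed

lemma opt_rule_slots:
  assumes "x \<in> vals" "y \<in> vals" "z \<in> vals"
  shows "opt_rule \<delta> x y z # opt_revealed \<delta> h y z \<in> slots"
    "opt_rule \<delta>' x y z # opt_revealed \<delta>' h y z \<in> slots"
proof -
  have "opt_rule \<delta> x y z \<in> vals" "opt_rule \<delta>' x y z \<in> vals"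
    "set (opt_revealed \<delta> h y z) \<subseteq> vals" "set (opt_revealed \<delta>' h y z) \<subseteq> vals"
    using assms xca_wf_delta(1)[OF wf] xca_wf_q(3)[OF wf]
    by (cases x; cases y; cases z; simp add: revealed_def)+
  then show "opt_rule \<delta> x y z # opt_revealed \<delta> h y z \<in> slots"
    "opt_rule \<delta>' x y z # opt_revealed \<delta>' h y z \<in> slots"
    using length_opt_revealed[of \<delta> h y z] length_opt_revealed[of \<delta>' h y z]
    by (auto simp: slots_def)
qed

sublocale sweeper_tm W phases letters "Init True" "\<lambda>a. (Inl a, [], [])"
proof
  have fin: "finite (xca_states A)" and inl: "range Inl \<subseteq> xca_states A"
    using wf by (simp_all add: xca_wf_def)
  have "finite vals" using fin by (simp add: vals_def)
  moreover from this have "finite slots"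
    unfolding slots_def by (rule finite_lists_length_le)
  ultimately show "finite phases" "finite letters"
    using fin by (simp_all add: finite_phases letters_def)
  show "inj (\<lambda>a. (Inl a, [], []))" by (auto simp: inj_on_def)
  show "range (\<lambda>a. (Inl a, [], [])) \<subseteq> letters"
    using inl by (auto simp: letters_def slots_intros)
  show "Init True \<in> phases" by simp
  note q = xca_wf_q(1)[OF wf]
  show "right_rule W s x \<in> phases \<times> letters" if "s \<in> phases" "x \<in> letters" for s x
  proof -
    obtain i r l where x: "x = (i, r, l)" "i \<in> xca_states A" "r \<in> slots" "l \<in> slots"
      using \<open>x \<in> letters\<close> by (auto simp: letters_def)
    show ?thesis
    proof (cases s)
      case (Gather p)
      then have "p \<in> insert None (Some ` (vals \<times> vals))" using \<open>s \<in> phases\<close> by (simp add: phases_def)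
      then show ?thesis using x hd_or_vals(1)[of r] hd_or_vals(1)[of l] Gather
        by (auto simp: W_def letters_def slots_intros)
    next
      case (Insert cr cl)
      then show ?thesis using x insert_slot_slots[of r cr] insert_slot_slots[of l cl] \<open>s \<in> phases\<close>
        by (simp add: W_def letters_def)
    qed (use x q \<open>s \<in> phases\<close> in \<open>simp_all add: W_def letters_def slots_intros\<close>)
  qed
  show "left_rule W s x \<in> phases \<times> letters" if "s \<in> phases" "x \<in> letters" for s x
  proof -
    obtain i r l where x: "x = (i, r, l)" "i \<in> xca_states A" "r \<in> slots" "l \<in> slots"
      using \<open>x \<in> letters\<close> by (auto simp: letters_def)
    show ?thesis
    proof (cases s)
      case (Update nr nl)
      then have "nr \<in> vals" "nl \<in> vals" using \<open>s \<in> phases\<close> by simp_all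
      then show ?thesis using x hd_or_vals[of r] hd_or_vals[of l] Update
        by (simp add: W_def letters_def Let_def opt_rule_slots)
    qed (use x \<open>s \<in> phases\<close> in \<open>simp_all add: W_def letters_def\<close>)
  qed
  show "right_end W s \<in> phases \<times> insert None (Some ` letters)" if "s \<in> phases" for s
    using that q by (cases s) (auto simp: W_def letters_def slots_intros)
  show "left_end W s \<in> Inl ` phases \<union> range Inr" if "s \<in> phases" for s
    using that by (cases s) (auto simp: W_def split: option.splits)
qed

section \<open>The effect of a single round in each phase\<close>

definition plain :: "('a + nat) letter list \<Rightarrow> bool" where
  "plain zs \<longleftrightarrow> (\<forall>z \<in> set zs. length (right_slot z) \<noteq> 2 \<and> length (left_slot z) \<noteq> 2)"

text \<open>\<open>Init\<close> rounds on a nonempty tape and \<open>Insert\<close> rounds all end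
  with this leftward sweep.\<close>

definition check :: "('a + nat) letter list \<Rightarrow> (('a + nat) phase \<times> ('a + nat) letter list) + bool" where
  "check zs = (case lend (Check (\<not> plain zs) (if zs = [] then [] else right_slot (hd zs))) of
     Inl s \<Rightarrow> Inl (s, zs) | Inr b \<Rightarrow> Inr b)"

lemma sweep_Check:
  "sweep lrule (Check False []) (rev zs) =
     (Check (\<not> plain zs) (if zs = [] then [] else right_slot (hd zs)), rev zs)"
  by (induction zs) (auto simp: sweep_append plain_def split: prod.splits)

lemma sweep_Init:
  "sweep rrule (Init False) zs = (Init False, map (\<lambda>z. (fst z, [Some (fst z)], [Some q])) zs)"
  by (induction zs) auto

lemma round_to_check:
  assumes "sweep rrule s xs = (s1, ys)" "rend s1 = (Check False [], a)"
  shows "sweep_round W (s, xs) = check (ys @ (case a of None \<Rightarrow> [] | Some x \<Rightarrow> [x]))"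
  unfolding sweep_round_def check_def W_def using assms
  by (simp only: sweeper.simps fst_conv snd_conv Let_def split sweep_Check rev_rev_ident)

lemma round_Init:
  "sweep_round W (Init True, (i, r, l) # zs) =
     check ((i, [Some i], [Some i]) # map (\<lambda>z. (fst z, [Some (fst z)], [Some q])) zs @
       [(q, [Some q], [Some q])])"
proof -
  have "sweep rrule (Init True) ((i, r, l) # zs) =
      (Init False, (i, [Some i], [Some i]) # map (\<lambda>z. (fst z, [Some (fst z)], [Some q])) zs)"
    by (simp add: sweep_Init)
  from round_to_check[OF this] show ?thesis by simp
qed

lemma round_Init_empty: "sweep_round W (Init True, []) = Inr e"
  by (simp add: sweep_round_def W_def)

definition insert_round :: "('a + nat) letter list \<Rightarrow> ('a + nat) letter list" where
  "insert_round zs = snd (sweep rrule (Insert None None) zs)"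

lemma sweep_Insert_phase: "\<exists>cr' cl'. fst (sweep rrule (Insert cr cl) zs) = Insert cr' cl'"
  by (induction zs arbitrary: cr cl) (auto split: prod.splits, metis fst_conv)

lemma sweep_Insert:
  "map right_slot (snd (sweep rrule (Insert cr cl) zs)) = snd (sweep insert_slot cr (map right_slot zs))"
  "map left_slot (snd (sweep rrule (Insert cr cl) zs)) = snd (sweep insert_slot cl (map left_slot zs))"
  "map fst (snd (sweep rrule (Insert cr cl) zs)) = map fst zs"
  by (induction zs arbitrary: cr cl) (auto simp: Let_def split: prod.splits, (metis fst_conv snd_conv)+)

lemma round_Insert: "sweep_round W (Insert None None, zs) = check (insert_round zs)"
proof -
  obtain cr cl where "fst (sweep rrule (Insert None None) zs) = Insert cr cl"
    using sweep_Insert_phase by blast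
  then have "sweep rrule (Insert None None) zs = (Insert cr cl, insert_round zs)"
    by (metis insert_round_def prod.collapse)
  from round_to_check[OF this] show ?thesis by simp
qed

definition next_right :: "('a + nat) letter list \<Rightarrow> ('a + nat) option" where
  "next_right zs = hd_or None (map (\<lambda>z. hd_or None (right_slot z)) zs)"

definition next_left :: "('a + nat) letter list \<Rightarrow> ('a + nat) option" where
  "next_left zs = hd_or None (map (\<lambda>z. hd_or None (left_slot z)) zs)"

text \<open>The joint effect of the \<open>Gather\<close> and \<open>Update\<close> sweeps as one
  recursion from the decision cell outward, shaped like \<open>opt_grow\<close>; \<open>a\<close>
  and \<open>b\<close> are the inner neighbours on the two tracks.\<close>

fun updated :: "('a + nat) option \<Rightarrow> ('a + nat) option \<Rightarrow> ('a + nat) letter list \<Rightarrow> ('a + nat) letter list" where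
  "updated a b [] = []"
| "updated a b ((i, r, l) # zs) =
     (i, opt_rule \<delta> a (hd_or None r) (next_right zs) # opt_revealed \<delta> h (hd_or None r) (next_right zs),
      opt_rule \<delta>' b (hd_or None l) (next_left zs) # opt_revealed \<delta>' h (hd_or None l) (next_left zs)) #
     updated (hd_or None r) (hd_or None l) zs"

lemma sweep_Gather_phase: "\<exists>p'. fst (sweep rrule (Gather p) zs) = Gather p'"
  by (induction zs arbitrary: p) (auto split: prod.splits, metis fst_conv)

lemma sweep_Update:
  "sweep lrule (Update None None) (rev (snd (sweep rrule (Gather (Some (a, b))) zs))) =
     (Update (next_right zs) (next_left zs), rev (updated a b zs))"
proof (induction zs arbitrary: a b)
  case (Cons z zs)
  obtain i r l where z: "z = (i, r, l)" by (metis prod_cases3)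
  have "snd (sweep rrule (Gather (Some (a, b))) (z # zs)) =
      (i, [a, hd_or None r], [b, hd_or None l]) #
      snd (sweep rrule (Gather (Some (hd_or None r, hd_or None l))) zs)"
    by (simp add: z case_prod_beta)
  then show ?case
    using Cons.IH[of "hd_or None r" "hd_or None l"]
    by (simp add: sweep_append z Let_def, simp add: next_right_def next_left_def)
qed (simp add: next_right_def next_left_def)

lemma round_Gather:
  "sweep_round W (Gather None, z # zs) =
     Inl (Insert None None, updated (next_left zs) (next_right zs) (z # zs))"
proof -
  obtain i r l where z: "z = (i, r, l)" by (metis prod_cases3)
  obtain p' ys where s: "sweep rrule (Gather (Some (hd_or None r, hd_or None l))) zs = (Gather p', ys)"
    using sweep_Gather_phase by (metis prod.collapse)
  show ?thesis
    using sweep_Update[of "hd_or None r" "hd_or None l" zs]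
    by (simp add: z s sweep_round_def W_def sweep_append Let_def)
qed

lemma map_fst_updated: "map fst (updated a b zs) = map fst zs"
  by (induction a b zs rule: updated.induct) auto

lemma concat_updated:
  "concat (map right_slot (updated a b zs)) = opt_grow \<delta> h a (map (\<lambda>z. hd_or None (right_slot z)) zs)"
  "concat (map left_slot (updated a b zs)) = opt_grow \<delta>' h b (map (\<lambda>z. hd_or None (left_slot z)) zs)"
  by (induction a b zs rule: updated.induct) (simp_all add: next_right_def next_left_def)

lemma length_updated_slots:
  "z \<in> set (updated a b zs) \<Longrightarrow> length (right_slot z) \<in> {1, 2} \<and> length (left_slot z) \<in> {1, 2}"
proof (induction a b zs rule: updated.induct)
  case (2 a b i r l zs)
  have l: "length (v # opt_revealed D h' x y) \<in> {1, 2}" for v D and h' :: "'a + nat" and x y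
    using length_opt_revealed[of D h' x y] by (cases "opt_revealed D h' x y") auto
  from 2(2) consider "z = hd (updated a b ((i, r, l) # zs))" | "z \<in> set (updated (hd_or None r) (hd_or None l) zs)"
    by auto
  then show ?case
  proof cases
    case 1
    then show ?thesis unfolding updated.simps list.sel by (simp only: fst_conv snd_conv l simp_thms)
  qed (rule 2(1))
qed simp

text \<open>Each insertion round separates at least one more slot of each track.\<close>

lemma Insert_halts:
  assumes "\<And>zs'. \<lbrakk>map fst zs' = map fst zs; length zs' = length zs;
      \<forall>z \<in> set zs'. length (right_slot z) = 1 \<and> length (left_slot z) = 1;
      concat (map right_slot zs') = take (length zs) (concat (map right_slot zs));
      concat (map left_slot zs') = take (length zs) (concat (map left_slot zs))\<rbrakk>
      \<Longrightarrow> sweep_halts W n b (check zs')"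
    and "\<forall>z \<in> set zs. length (right_slot z) \<in> {1, 2} \<and> length (left_slot z) \<in> {1, 2}"
    and "\<forall>z \<in> set (take k zs). length (right_slot z) = 1 \<and> length (left_slot z) = 1"
  shows "sweep_halts W (n + Suc (length zs - k)) b (Inl (Insert None None, zs))"
  using assms
proof (induction "length zs - k" arbitrary: zs k rule: less_induct)
  case less
  let ?zs = "insert_round zs"
  have m: "map right_slot ?zs = snd (sweep insert_slot None (map right_slot zs))"
    "map left_slot ?zs = snd (sweep insert_slot None (map left_slot zs))"
    "map fst ?zs = map fst zs"
    by (simp_all add: insert_round_def sweep_Insert)
  have len: "length ?zs = length zs" by (simp add: insert_round_def)
  have "\<forall>s \<in> set (map right_slot zs). length s \<in> {1, 2}" "\<forall>s \<in> set (map left_slot zs). length s \<in> {1, 2}"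
    using less.prems(2) by auto
  note R = sweep_insert_slot[OF this(1), of k, folded m(1,2)]
    and L = sweep_insert_slot[OF this(2), of k, folded m(1,2)]
  have lens: "\<forall>z \<in> set ?zs. length (right_slot z) \<in> {1, 2} \<and> length (left_slot z) \<in> {1, 2}"
    using R[THEN conjunct1] L[THEN conjunct1] unfolding set_map by blast
  have conc: "take (length zs) (concat (map right_slot ?zs)) = take (length zs) (concat (map right_slot zs))"
    "take (length zs) (concat (map left_slot ?zs)) = take (length zs) (concat (map left_slot zs))"
    using R[THEN conjunct2, THEN conjunct1] L[THEN conjunct2, THEN conjunct1]
    unfolding length_map .
  have "\<forall>z \<in> set (take (Suc k) ?zs). length (right_slot z) = 1"
    using R[THEN conjunct2, THEN conjunct2] less.prems(3) unfolding take_map set_map by blast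
  moreover have "\<forall>z \<in> set (take (Suc k) ?zs). length (left_slot z) = 1"
    using L[THEN conjunct2, THEN conjunct2] less.prems(3) unfolding take_map set_map by blast
  ultimately have lead: "\<forall>z \<in> set (take (Suc k) ?zs). length (right_slot z) = 1 \<and> length (left_slot z) = 1"
    by blast
  show ?case
  proof (cases "plain ?zs")
    case True
    then have one: "\<forall>z \<in> set ?zs. length (right_slot z) = 1 \<and> length (left_slot z) = 1"
      using lens by (auto simp: plain_def)
    have "length (concat (map right_slot zs')) = length zs' \<and> length (concat (map left_slot zs')) = length zs'"
      if "\<forall>z \<in> set zs'. length (right_slot z) = 1 \<and> length (left_slot z) = 1" for zs' :: "('a + nat) letter list"
      using that by (induction zs') auto
    from this[OF one] have "concat (map right_slot ?zs) = take (length zs) (concat (map right_slot zs))"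
      "concat (map left_slot ?zs) = take (length zs) (concat (map left_slot zs))"
      using conc len by simp_all
    then have "sweep_halts W n b (check ?zs)"
      using less.prems(1)[of ?zs] m(3) len one by blast
    then show ?thesis
      by (simp add: round_Insert) (rule sweep_halts_mono, assumption, simp)
  next
    case False
    \<comment> \<open>Otherwise \<open>lead\<close> would cover all slots and the tape would be
      plain; so the measure \<open>length zs - k\<close> can still drop.\<close>
    have k: "k < length zs"
    proof (rule ccontr)
      assume "\<not> k < length zs"
      then have "take (Suc k) ?zs = ?zs" using len by simp
      then show False using lead False by (simp add: plain_def)
    qed
    have "sweep_halts W (n + Suc (length ?zs - Suc k)) b (Inl (Insert None None, ?zs))"
    proof (rule less.hyps)
      show "length ?zs - Suc k < length zs - k" using k len by simp
      show "sweep_halts W n b (check zs')"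
        if "map fst zs' = map fst ?zs" "length zs' = length ?zs"
          "\<forall>z\<in>set zs'. length (right_slot z) = 1 \<and> length (left_slot z) = 1"
          "concat (map right_slot zs') = take (length ?zs) (concat (map right_slot ?zs))"
          "concat (map left_slot zs') = take (length ?zs) (concat (map left_slot ?zs))" for zs'
        using that m(3) len conc by (intro less.prems(1)) simp_all
    qed (use lens lead in blast)+
    moreover have "check ?zs = Inl (Insert None None, ?zs)" using False by (simp add: check_def)
    moreover have "n + Suc (length ?zs - Suc k) = n + (length zs - k)" using k len by simp
    ultimately have "sweep_halts W (n + (length zs - k)) b (check ?zs)" by (simp only:)
    then show ?thesis by (simp only: add_Suc_right sweep_halts.simps round_Insert)
  qed
qed


text \<open>A neighbour missing on either side makes the decision cell unknown after the step, which
  is what calls for a restart.\<close>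

lemma take_opt_grow_unknown:
  assumes "tr \<noteq> []" "hd_or None (tl tr) = None \<or> p = None"
  shows "hd_or None (take (length tr) (opt_grow D h' p tr)) = None"
  using assms by (cases tr) auto

lemma window_next:
  assumes "window q N t xs tr"
  shows "hd_or None (tl tr) = Some (hd_or q (tl xs)) \<or> (hd_or None (tl tr) = None \<and> N \<le> Suc t)"
proof -
  obtain ks m where k: "tr = map Some ks @ replicate m None" "agrees q ks xs" "N \<le> length ks + t"
    using assms by (auto simp: window_def)
  have None: "hd_or None (tl (replicate m None)) = None" for m by (cases m) auto
  consider "ks = []" | x where "ks = [x]" | x y ks' where "ks = x # y # ks'"
    by (metis list.exhaust)
  then show ?thesis using k None by cases auto
qed

lemma window_hd:
  assumes "window q N t xs tr"
  shows "hd_or None tr = Some (hd_or q xs) \<or> (hd_or None tr = None \<and> N \<le> t)"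
proof -
  obtain ks m where "tr = map Some ks @ replicate m None" "agrees q ks xs" "N \<le> length ks + t"
    using assms by (auto simp: window_def)
  then show ?thesis by (cases ks) auto
qed

section \<open>Correctness of the simulation, restarts and the number of rounds\<close>

definition run_right :: "'a list \<Rightarrow> nat \<Rightarrow> ('a + nat) list" where
  "run_right w t = (case (xca_step A ^^ t) (xca_init w) of (c, d) \<Rightarrow> drop d c)"

definition run_left :: "'a list \<Rightarrow> nat \<Rightarrow> ('a + nat) list" where
  "run_left w t = (case (xca_step A ^^ t) (xca_init w) of (c, d) \<Rightarrow> rev (take (Suc d) c))"

lemma run_config:
  assumes "w \<noteq> []"
  shows "\<exists>c d. (xca_step A ^^ t) (xca_init w) = (c, d) \<and> d < length c \<and>
    set c \<subseteq> xca_states A - {h}"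
proof (induction t)
  case 0
  have "range Inl \<subseteq> xca_states A" "h \<notin> range Inl" using wf by (simp_all add: xca_wf_def)
  then have "Inl x \<in> xca_states A" "Inl x \<noteq> h" for x by (auto, metis rangeI)
  then have "set (map Inl w) \<subseteq> xca_states A - {h}" by auto
  then show ?case using assms by (simp add: xca_init_def)
next
  case (Suc t)
  then obtain c d where c: "(xca_step A ^^ t) (xca_init w) = (c, d)" "d < length c"
    "set c \<subseteq> xca_states A - {h}" by blast
  obtain c' d' where st: "xca_step A (c, d) = (c', d')" by fastforce
  then show ?case using xca_step_halves(1,2)[OF wf c(3,2) st] c(1) by auto
qed

lemma run_halves_Suc:
  assumes "w \<noteq> []"
  shows "run_right w (Suc t) = grow \<delta> q h (hd_or q (tl (run_left w t))) (run_right w t @ [q])"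
    "run_left w (Suc t) = grow \<delta>' q h (hd_or q (tl (run_right w t))) (run_left w t @ [q])"
proof -
  obtain c d where c: "(xca_step A ^^ t) (xca_init w) = (c, d)" "d < length c"
    "set c \<subseteq> xca_states A - {h}" using run_config[OF assms] by blast
  obtain c' d' where st: "xca_step A (c, d) = (c', d')" by fastforce
  note s = xca_step_halves(3,4)[OF wf c(3,2) st]
  show "run_right w (Suc t) = grow \<delta> q h (hd_or q (tl (run_left w t))) (run_right w t @ [q])"
    using s(1) by (simp add: run_right_def run_left_def c(1) st)
  show "run_left w (Suc t) = grow \<delta>' q h (hd_or q (tl (run_right w t))) (run_left w t @ [q])"
    using s(2) by (simp add: run_right_def run_left_def c(1) st)
qed

lemma hd_run_right:
  assumes "w \<noteq> []"
  shows "hd_or q (run_right w t) = xca_dec A w t"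
proof -
  obtain c d where c: "(xca_step A ^^ t) (xca_init w) = (c, d)" "d < length c"
    using run_config[OF assms] by blast
  then have "drop d c = c ! d # drop (Suc d) c" by (simp add: Cons_nth_drop_Suc)
  then show ?thesis by (simp add: run_right_def xca_dec_def c(1))
qed

definition right_track :: "('a + nat) letter list \<Rightarrow> ('a + nat) option list" where
  "right_track zs = map (\<lambda>z. hd_or None (right_slot z)) zs"

definition left_track :: "('a + nat) letter list \<Rightarrow> ('a + nat) option list" where
  "left_track zs = map (\<lambda>z. hd_or None (left_slot z)) zs"

definition singletons :: "('a + nat) letter list \<Rightarrow> bool" where
  "singletons zs \<longleftrightarrow> (\<forall>z \<in> set zs. length (right_slot z) = 1 \<and> length (left_slot z) = 1)"

lemma concat_singletons:
  assumes "singletons zs"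
  shows "concat (map right_slot zs) = right_track zs" "concat (map left_slot zs) = left_track zs"
proof -
  have *: "[hd_or None s] = s" if "length s = 1" for s :: "('a + nat) option list"
    using that by (cases s) auto
  have "concat (map right_slot zs) = right_track zs \<and> concat (map left_slot zs) = left_track zs"
    using assms
  proof (induction zs)
    case (Cons z zs)
    then have "[hd_or None (right_slot z)] = right_slot z" "[hd_or None (left_slot z)] = left_slot z"
      by (auto simp: singletons_def intro!: *)
    then show ?case using Cons
      by (simp add: singletons_def right_track_def left_track_def)
  qed (simp add: right_track_def left_track_def)
  then show "concat (map right_slot zs) = right_track zs" "concat (map left_slot zs) = left_track zs"
    by auto
qed

lemma check_singletons:
  assumes "singletons zs" "zs \<noteq> []"
  shows "check zs = (case hd_or None (right_track zs) of None \<Rightarrow> Inl (Init True, zs)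
    | Some x \<Rightarrow> if x = xca_acc A then Inr True else if x = xca_rej A then Inr False
        else Inl (Gather None, zs))"
proof -
  have "plain zs" using assms(1) by (auto simp: plain_def singletons_def)
  moreover have "hd_or None (right_track zs) = hd_or None (right_slot (hd zs))"
    using assms(2) by (cases zs) (simp_all add: right_track_def)
  ultimately show ?thesis using assms(2) by (simp add: check_def split: option.split)
qed

text \<open>One simulated step takes a \<open>Gather\<close> round and at most
  \<open>length zs + 1\<close> insertion rounds; \<open>K\<close> pays for a restart. The second
  alternative in \<open>tracks\<close> is there because, with an unknown inner neighbour, a track
  need no longer be a known prefix followed by unknowns; all that is kept is that the decision cell
  is unknown.\<close>

lemma simulate:
  assumes w: "w \<noteq> []" and t: "t \<le> u"
    and dec: "xca_dec A w u = (if b then xca_acc A else xca_rej A)"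
    and undec: "\<And>t. t < u \<Longrightarrow> xca_dec A w t \<noteq> xca_acc A \<and> xca_dec A w t \<noteq> xca_rej A"
    and restart: "\<And>zs'. length zs \<le> u \<Longrightarrow> map fst zs' = map fst zs \<Longrightarrow>
        sweep_halts W K b (Inl (Init True, zs'))"
    and ne: "zs \<noteq> []" and sing: "singletons zs"
    and tracks: "window q (length zs) t (run_right w t) (right_track zs) \<and>
        window q (length zs) t (run_left w t) (left_track zs) \<or>
      hd_or None (right_track zs) = None \<and> length zs \<le> u"
  shows "sweep_halts W ((u - t) * (length zs + 2) + K) b (check zs)"
  using t restart ne sing tracks
proof (induction "u - t" arbitrary: t zs rule: less_induct)
  case less
  note restart = less.prems(2) and chk = check_singletons[OF less.prems(4,3)]
  let ?N = "length zs"
  show ?case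
  proof (cases "hd_or None (right_track zs)")
    case None
    \<comment> \<open>The decision cell can be unknown only in a window no longer than the halting
      time; this keeps the number of restarts bounded.\<close>
    then have "?N \<le> u" using less.prems(1,5) window_hd by fastforce
    then have "sweep_halts W K b (check zs)" using restart None chk by simp
    then show ?thesis by (rule sweep_halts_mono) simp
  next
    case (Some x)
    then have win: "window q ?N t (run_right w t) (right_track zs)"
      "window q ?N t (run_left w t) (left_track zs)" using less.prems(5) by auto
    have x: "x = xca_dec A w t" using window_hd[OF win(1)] Some hd_run_right[OF w] by simp
    show ?thesis
    proof (cases "t = u")
      case True
      have "xca_acc A \<noteq> xca_rej A" using wf by (simp add: xca_wf_def)
      then have "check zs = Inr b" using chk Some x dec True by (simp split: if_splits)
      then show ?thesis by simp
    next
      case False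
      then have tu: "t < u" using less.prems(1) by simp
      have chk': "check zs = Inl (Gather None, zs)" using chk Some x undec[OF tu] by simp
      obtain z zs1 where zs: "zs = z # zs1" using less.prems(3) by (cases zs) auto
      define ys where "ys = updated (next_left zs1) (next_right zs1) zs"
      have nl: "next_left zs1 = hd_or None (tl (left_track zs))"
        and nr: "next_right zs1 = hd_or None (tl (right_track zs))"
        by (simp_all add: zs next_left_def next_right_def left_track_def right_track_def)
      have len: "length ys = ?N" unfolding ys_def using map_fst_updated by (metis length_map)
      have fst_ys: "map fst ys = map fst zs" unfolding ys_def by (rule map_fst_updated)
      have grown: "concat (map right_slot ys) = opt_grow \<delta> h (hd_or None (tl (left_track zs))) (right_track zs)"
        "concat (map left_slot ys) = opt_grow \<delta>' h (hd_or None (tl (right_track zs))) (left_track zs)"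
        unfolding ys_def concat_updated nl nr right_track_def left_track_def by (rule refl)+
      define m where "m = (u - Suc t) * (?N + 2) + K"
      have "sweep_halts W (m + Suc (length ys - 0)) b (Inl (Insert None None, ys))"
      proof (rule Insert_halts)
        fix zs' :: "('a + nat) letter list"
        assume fst': "map fst zs' = map fst ys" and len': "length zs' = length ys"
          and sing': "\<forall>z \<in> set zs'. length (right_slot z) = 1 \<and> length (left_slot z) = 1"
          and conc: "concat (map right_slot zs') = take (length ys) (concat (map right_slot ys))"
            "concat (map left_slot zs') = take (length ys) (concat (map left_slot ys))"
        have s': "singletons zs'" using sing' by (simp add: singletons_def)
        have tr: "right_track zs' = take ?N (opt_grow \<delta> h (hd_or None (tl (left_track zs))) (right_track zs))"
          "left_track zs' = take ?N (opt_grow \<delta>' h (hd_or None (tl (right_track zs))) (left_track zs))"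
          using conc unfolding concat_singletons[OF s'] grown len by simp_all
        have N': "length zs' = ?N" using len' len by simp
        have tracks': "window q (length zs') (Suc t) (run_right w (Suc t)) (right_track zs') \<and>
            window q (length zs') (Suc t) (run_left w (Suc t)) (left_track zs') \<or>
            hd_or None (right_track zs') = None \<and> length zs' \<le> u"
        proof (cases "hd_or None (tl (left_track zs)) \<noteq> None \<and> hd_or None (tl (right_track zs)) \<noteq> None")
          case True
          then have l: "hd_or None (tl (left_track zs)) = Some (hd_or q (tl (run_left w t)))"
            and r: "hd_or None (tl (right_track zs)) = Some (hd_or q (tl (run_right w t)))"
            using window_next[OF win(1)] window_next[OF win(2)] by auto
          have "window q ?N (Suc t) (run_right w (Suc t)) (right_track zs')"
            unfolding run_halves_Suc[OF w] tr l
            by (rule window_grow) (use xca_wf_q[OF wf] win(1) in simp_all)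
          moreover have "window q ?N (Suc t) (run_left w (Suc t)) (left_track zs')"
            unfolding run_halves_Suc[OF w] tr r
            by (rule window_grow) (use xca_wf_q[OF wf] win(2) in simp_all)
          ultimately show ?thesis unfolding N' by blast
        next
          case False
          have "length (right_track zs) = ?N" by (simp add: right_track_def)
          then have "hd_or None (right_track zs') = None"
            unfolding tr using take_opt_grow_unknown[of "right_track zs"] False less.prems(3)
            by (metis length_0_conv)
          \<comment> \<open>A neighbour of the decision cell lies outside the known part of its
            track, which still has at least \<open>?N - t\<close> cells.\<close>
          moreover have "?N \<le> Suc t"
            using False window_next[OF win(1)] window_next[OF win(2)] by auto
          ultimately show ?thesis unfolding N' using tu by simp
        qed
        have "sweep_halts W ((u - Suc t) * (length zs' + 2) + K) b (check zs')"
        proof (rule less.hyps)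
          show "u - Suc t < u - t" using tu by simp
          show "Suc t \<le> u" using tu by simp
          show "sweep_halts W K b (Inl (Init True, zs''))"
            if "length zs' \<le> u" "map fst zs'' = map fst zs'" for zs''
            using restart[of zs''] that N' fst' fst_ys by simp
          show "zs' \<noteq> []" using N' less.prems(3) by auto
        qed (rule s', rule tracks')
        then show "sweep_halts W m b (check zs')" by (simp only: m_def N')
      next
        show "\<forall>z\<in>set ys. length (right_slot z) \<in> {1, 2} \<and> length (left_slot z) \<in> {1, 2}"
          unfolding ys_def using length_updated_slots by blast
      qed simp
      moreover have "sweep_round W (Gather None, zs) = Inl (Insert None None, ys)"
        using round_Gather[of z zs1] by (simp only: ys_def zs)
      ultimately have "sweep_halts W (Suc (m + Suc ?N)) b (check zs)"
        by (simp only: chk' sweep_halts.simps len diff_zero)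
      moreover have "Suc (m + Suc ?N) \<le> (u - t) * (?N + 2) + K"
      proof -
        have "u - t = Suc (u - Suc t)" using tu by simp
        then show ?thesis by (simp add: m_def)
      qed
      ultimately show ?thesis by (rule sweep_halts_mono)
    qed
  qed
qed

text \<open>The first components of the letters are never overwritten, so the initial configuration
  can be rebuilt with one more quiescent cell. The count is one \<open>Init\<close> round plus
  \<open>simulate\<close> at time \<open>0\<close> on a tape of length
  \<open>length zs + 1\<close>.\<close>

lemma Init_halts:
  assumes w: "w \<noteq> []"
    and dec: "xca_dec A w u = (if b then xca_acc A else xca_rej A)"
    and undec: "\<And>t. t < u \<Longrightarrow> xca_dec A w t \<noteq> xca_acc A \<and> xca_dec A w t \<noteq> xca_rej A"
    and zs: "map fst zs = map Inl w @ replicate m q"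
    and restart: "\<And>zs'. length zs < u \<Longrightarrow> length zs' = Suc (length zs) \<Longrightarrow>
        map fst zs' = map Inl w @ replicate (Suc m) q \<Longrightarrow> sweep_halts W K b (Inl (Init True, zs'))"
  shows "sweep_halts W (Suc (u * (length zs + 3) + K)) b (Inl (Init True, zs))"
proof -
  have "zs \<noteq> []" using w zs by (cases zs) auto
  then obtain i r l zs1 where z: "zs = (i, r, l) # zs1" by (cases zs) auto
  obtain a w' where aw: "w = a # w'" using w by (cases w) auto
  have i: "i = Inl a" "map fst zs1 = map Inl w' @ replicate m q" using zs by (simp_all add: z aw)
  define ys where "ys = (i, [Some i], [Some i]) # map (\<lambda>z. (fst z, [Some (fst z)], [Some q])) zs1 @
       [(q, [Some q], [Some q])]"
  have round: "sweep_round W (Init True, zs) = check ys" unfolding z ys_def by (rule round_Init)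
  have len: "length ys = Suc (length zs)" by (simp add: ys_def z)
  have sing: "singletons ys" by (auto simp: singletons_def ys_def)
  have "map fst ys = map fst zs @ [q]" by (simp add: ys_def z o_def)
  then have fst_ys: "map fst ys = map Inl w @ replicate (Suc m) q"
    by (simp add: zs replicate_append_same)
  have right: "right_track ys = map Some (map fst ys) @ replicate 0 None"
    by (simp add: right_track_def ys_def o_def)
  \<comment> \<open>Initially the decision cell is the leftmost active one, so the rest of its left
    half-line is quiescent.\<close>
  have left: "left_track ys = map Some (Inl a # replicate (length zs) q) @ replicate 0 None"
    by (simp add: left_track_def ys_def o_def z i(1) map_replicate_const replicate_append_same)
  have "window q (length ys) 0 (run_right w 0) (right_track ys)"
    unfolding window_def right
  proof (intro conjI exI)
    show "agrees q (map fst ys) (run_right w 0)"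
      using agrees_append_same[of q "map Inl w" "replicate (Suc m) q" "[]"]
        agrees_replicate[of q "Suc m"]
      by (simp add: fst_ys run_right_def xca_init_def)
  qed simp_all
  moreover have "window q (length ys) 0 (run_left w 0) (left_track ys)"
    unfolding window_def left
  proof (intro conjI exI)
    show "agrees q (Inl a # replicate (length zs) q) (run_left w 0)"
      using agrees_replicate by (simp add: run_left_def xca_init_def aw)
  qed (simp_all add: len)
  ultimately have "sweep_halts W ((u - 0) * (length ys + 2) + K) b (check ys)"
  proof (intro simulate[OF w _ dec undec _ _ sing] disjI1 conjI)
    show "sweep_halts W K b (Inl (Init True, zs'))"
      if "length ys \<le> u" "map fst zs' = map fst ys" for zs'
    proof (rule restart)
      show "length zs < u" using that(1) len by simp
      show "length zs' = Suc (length zs)" using that(2) len by (metis length_map)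
      show "map fst zs' = map Inl w @ replicate (Suc m) q" using that(2) fst_ys by simp
    qed
    show "ys \<noteq> []" by (simp add: ys_def)
  qed simp_all
  then show ?thesis by (simp add: round len numeral_3_eq_3)
qed

text \<open>\<open>j\<close> bounds the restarts still to come. For \<open>j = 0\<close> the tape
  has at least \<open>u\<close> letters, the next window is longer than \<open>u\<close>, and the
  restart premise of \<open>Init_halts\<close> is vacuous. \<open>B\<close> bounds the tape at the
  start of every attempt.\<close>

lemma restart_halts:
  assumes w: "w \<noteq> []"
    and dec: "xca_dec A w u = (if b then xca_acc A else xca_rej A)"
    and undec: "\<And>t. t < u \<Longrightarrow> xca_dec A w t \<noteq> xca_acc A \<and> xca_dec A w t \<noteq> xca_rej A"
    and zs: "map fst zs = map Inl w @ replicate m q"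
    and j: "u \<le> length zs + j" "length zs + j \<le> B"
  shows "sweep_halts W (Suc j * (1 + u * (B + 3))) b (Inl (Init True, zs))"
  using zs j
proof (induction j arbitrary: zs m)
  case 0
  have "sweep_halts W (Suc (u * (length zs + 3) + 0)) b (Inl (Init True, zs))"
    using 0(2) by (intro Init_halts[OF w dec undec 0(1)]) simp_all
  moreover have "u * (length zs + 3) \<le> u * (B + 3)" using 0(3) by (intro mult_le_mono2) simp
  ultimately show ?case by (elim sweep_halts_mono) simp
next
  case (Suc j)
  let ?K = "Suc j * (1 + u * (B + 3))"
  have "sweep_halts W (Suc (u * (length zs + 3) + ?K)) b (Inl (Init True, zs))"
  proof (intro Init_halts[OF w dec undec Suc.prems(1)])
    show "sweep_halts W ?K b (Inl (Init True, zs'))"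
      if "length zs' = Suc (length zs)" "map fst zs' = map Inl w @ replicate (Suc m) q" for zs'
      using Suc.prems(2,3) that by (intro Suc.IH[of _ "Suc m"]) simp_all
  qed
  moreover have "u * (length zs + 3) \<le> u * (B + 3)" using Suc.prems(3) by (intro mult_le_mono2) simp
  ultimately show ?case by (elim sweep_halts_mono) simp
qed

lemma xca_halts:
  assumes "xca_decides_in_time A L T" "e \<longleftrightarrow> [] \<in> L"
  defines "K \<equiv> \<lambda>n. (T n + 2) * (1 + T n * (n + T n + 4))"
  shows "sweep_halts W (K (length w)) (w \<in> L) (Inl (Init True, map (\<lambda>a. (Inl a, [], [])) w))"
proof (cases "w = []")
  case True
  obtain n where "K 0 = Suc n" by (cases "K 0") (auto simp: K_def)
  then have "sweep_halts W (K 0) e (Inl (Init True, []))" by (simp add: round_Init_empty)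
  then show ?thesis using True assms(2) by (simp only: list.size list.map)
next
  case False
  let ?n = "length w"
  obtain u where u: "u \<le> T ?n" "xca_dec A w u = xca_acc A \<or> xca_dec A w u = xca_rej A"
    "\<And>t. t < u \<Longrightarrow> xca_dec A w t \<noteq> xca_acc A \<and> xca_dec A w t \<noteq> xca_rej A"
    "xca_dec A w u = xca_acc A \<longleftrightarrow> w \<in> L"
    using assms(1) False unfolding xca_decides_in_time_def by blast
  have dec: "xca_dec A w u = (if w \<in> L then xca_acc A else xca_rej A)" using u(2,4) by auto
  \<comment> \<open>The instance \<open>j = Suc u\<close>, \<open>B = ?n + Suc u\<close>: whatever
    the length of \<open>w\<close>, this leaves enough restarts.\<close>
  have "sweep_halts W (Suc (Suc u) * (1 + u * ((?n + Suc u) + 3))) (w \<in> L)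
      (Inl (Init True, map (\<lambda>a. (Inl a, [], [])) w))"
    by (rule restart_halts[OF False dec u(3), where m = 0]) (simp_all add: o_def)
  moreover have "Suc (Suc u) * (1 + u * ((?n + Suc u) + 3)) \<le> K ?n"
  proof -
    have "Suc (Suc u) \<le> T ?n + 2" "?n + Suc u + 3 \<le> ?n + T ?n + 4" using u(1) by simp_all
    then show ?thesis unfolding K_def using u(1) by (intro mult_le_mono add_left_mono)
  qed
  ultimately show ?thesis by (rule sweep_halts_mono)
qed

end

lemma class_1XCAP_subset_P: "(class_1XCAP :: ('a::finite) list set set) \<subseteq> class_P"
proof
  fix L :: "'a list set"
  assume "L \<in> class_1XCAP"
  then obtain A c k where A: "xca_wf A" "xca_decides_in_time A L (\<lambda>n. c * n ^ k + c)"
    by (auto simp: class_1XCAP_def)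
  interpret xca_simulation A "[] \<in> L" by standard (rule A(1))
  define T where "T = (\<lambda>n::nat. c * n ^ k + c)"
  define K where "K = (\<lambda>n. (T n + 2) * (1 + T n * (n + T n + 4)))"
  have "poly_bounded T" unfolding poly_bounded_def T_def by blast
  then have "poly_bounded K"
    unfolding K_def
    by (intro poly_bounded_mult poly_bounded_add poly_bounded_const poly_bounded_id)
  then have "poly_bounded (\<lambda>n. K n * (2 * (n + K n) + 3))"
    by (intro poly_bounded_mult poly_bounded_add poly_bounded_const poly_bounded_id)
  moreover have "tm_decides_in_time machine L (\<lambda>n. K n * (2 * (n + K n) + 3))"
    by (rule machine_decides) (use xca_halts[of L T] A(2) in \<open>simp add: K_def T_def\<close>)
  ultimately show "L \<in> class_P" using class_P_I machine_wf by blast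
qed

theorem theorem7:
  shows "(class_1XCAP :: ('a::finite) list set set) = class_P"
  using class_1XCAP_subset_P class_P_subset_1XCAP by (rule subset_antisym)

end
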